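(* The following is provable in ZF (without the Axiom of Choice): for every natural number $n\ge 2$, the statement $\mathcal{P}_n$ is equivalent to the statement $AC_n$.
   Context: $K_n$ is the complete graph on $n$ vertices. An independent set in a graph is a set of vertices no two of which are joined by an edge; a maximal independent set is an independent set that is not properly contained in any other independent set. $\mathcal{P}_n$: every graph all of whose connected components are (isomorphic to) $K_n$ has a maximal independent set. $AC_n$: every family of $n$-element sets has a choice function. *)

theory Defs
  imports Main
begin

text \<open>
  Since HOL itself proves the axiom of choice, provability in ZF is expressed by a deep embedding:
  classical first-order logic with equality over the single binary relation symbol \<open>\<in>\<close>.
  Variables are de Bruijn indices; as there are no function symbols, variables are the only terms.
\<close>

datatype fm =
    Mem nat nat  (infix \<open>\<^bold>\<in>\<close> 50)
  | Eq nat nat   (infix \<open>\<^bold>=\<close> 50)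
  | Bot
  | Imp fm fm    (infixr \<open>\<^bold>\<longrightarrow>\<close> 25)
  | All fm       (\<open>(\<^bold>\<forall>_)\<close> [10] 10)

definition Neg :: "fm \<Rightarrow> fm"  (\<open>\<^bold>\<not> _\<close> [40] 40)
  where "(\<^bold>\<not> p) = (p \<^bold>\<longrightarrow> Bot)"

definition Or :: "fm \<Rightarrow> fm \<Rightarrow> fm"  (infixr \<open>\<^bold>\<or>\<close> 30)
  where "(p \<^bold>\<or> q) = (\<^bold>\<not> p \<^bold>\<longrightarrow> q)"

definition And :: "fm \<Rightarrow> fm \<Rightarrow> fm"  (infixr \<open>\<^bold>\<and>\<close> 35)
  where "(p \<^bold>\<and> q) = (\<^bold>\<not> (p \<^bold>\<longrightarrow> \<^bold>\<not> q))"

definition Iff :: "fm \<Rightarrow> fm \<Rightarrow> fm"  (infixr \<open>\<^bold>\<longleftrightarrow>\<close> 25)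
  where "(p \<^bold>\<longleftrightarrow> q) = ((p \<^bold>\<longrightarrow> q) \<^bold>\<and> (q \<^bold>\<longrightarrow> p))"

definition Ex :: "fm \<Rightarrow> fm"  (\<open>(\<^bold>\<exists>_)\<close> [10] 10)
  where "(\<^bold>\<exists>p) = (\<^bold>\<not> (\<^bold>\<forall>\<^bold>\<not> p))"

text \<open>Quantifiers bounded by the variable \<open>x\<close>, where \<open>x\<close> is counted outside the new binder.\<close>

definition BAll :: "nat \<Rightarrow> fm \<Rightarrow> fm"  (\<open>(\<^bold>\<forall>\<in>_./ _)\<close> [0, 10] 10)
  where "(\<^bold>\<forall>\<in>x. p) = (\<^bold>\<forall>(0 \<^bold>\<in> Suc x \<^bold>\<longrightarrow> p))"

definition BEx :: "nat \<Rightarrow> fm \<Rightarrow> fm"  (\<open>(\<^bold>\<exists>\<in>_./ _)\<close> [0, 10] 10)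
  where "(\<^bold>\<exists>\<in>x. p) = (\<^bold>\<exists>(0 \<^bold>\<in> Suc x \<^bold>\<and> p))"

fun fv :: "fm \<Rightarrow> nat set" where
  "fv (x \<^bold>\<in> y) = {x, y}"
| "fv (x \<^bold>= y) = {x, y}"
| "fv Bot = {}"
| "fv (p \<^bold>\<longrightarrow> q) = fv p \<union> fv q"
| "fv (\<^bold>\<forall>p) = {n. Suc n \<in> fv p}"


subsection \<open>Renaming of variables\<close>

fun up :: "(nat \<Rightarrow> nat) \<Rightarrow> nat \<Rightarrow> nat" where
  "up r 0 = 0"
| "up r (Suc n) = Suc (r n)"

fun ren :: "(nat \<Rightarrow> nat) \<Rightarrow> fm \<Rightarrow> fm" where
  "ren r (x \<^bold>\<in> y) = (r x \<^bold>\<in> r y)"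
| "ren r (x \<^bold>= y) = (r x \<^bold>= r y)"
| "ren r Bot = Bot"
| "ren r (p \<^bold>\<longrightarrow> q) = (ren r p \<^bold>\<longrightarrow> ren r q)"
| "ren r (\<^bold>\<forall>p) = (\<^bold>\<forall>(ren (up r) p))"

text \<open>\<open>inst x p\<close> instantiates the outermost variable \<open>0\<close> of \<open>p\<close> by \<open>x\<close>, removing its binder.\<close>

definition inst :: "nat \<Rightarrow> fm \<Rightarrow> fm"
  where "inst x = ren (case_nat x (\<lambda>n. n))"


subsection \<open>Natural deduction for classical first-order logic with equality\<close>

inductive derives :: "fm set \<Rightarrow> fm \<Rightarrow> bool"  (infix \<open>\<turnstile>\<close> 5) where
  Assm: "p \<in> \<Gamma> \<Longrightarrow> \<Gamma> \<turnstile> p"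
| ImpI: "insert p \<Gamma> \<turnstile> q \<Longrightarrow> \<Gamma> \<turnstile> p \<^bold>\<longrightarrow> q"
| ImpE: "\<Gamma> \<turnstile> p \<^bold>\<longrightarrow> q \<Longrightarrow> \<Gamma> \<turnstile> p \<Longrightarrow> \<Gamma> \<turnstile> q"
| Contr: "insert (\<^bold>\<not> p) \<Gamma> \<turnstile> Bot \<Longrightarrow> \<Gamma> \<turnstile> p"
| AllI: "ren Suc ` \<Gamma> \<turnstile> p \<Longrightarrow> \<Gamma> \<turnstile> (\<^bold>\<forall>p)"
| AllE: "\<Gamma> \<turnstile> (\<^bold>\<forall>p) \<Longrightarrow> \<Gamma> \<turnstile> inst x p"
| EqRefl: "\<Gamma> \<turnstile> x \<^bold>= x"
| EqSubst: "\<Gamma> \<turnstile> x \<^bold>= y \<Longrightarrow> \<Gamma> \<turnstile> inst x p \<Longrightarrow> \<Gamma> \<turnstile> inst y p"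


subsection \<open>Basic set-theoretic predicates\<close>

definition subset_fm :: "nat \<Rightarrow> nat \<Rightarrow> fm"
  where "subset_fm x y = (\<^bold>\<forall>\<in>x. 0 \<^bold>\<in> Suc y)"

definition empty_fm :: "nat \<Rightarrow> fm"
  where "empty_fm x = (\<^bold>\<forall>\<^bold>\<not> 0 \<^bold>\<in> Suc x)"

text \<open>\<open>z = {x, y}\<close>\<close>
definition upair_fm :: "nat \<Rightarrow> nat \<Rightarrow> nat \<Rightarrow> fm"
  where "upair_fm x y z = (\<^bold>\<forall>(0 \<^bold>\<in> Suc z \<^bold>\<longleftrightarrow> 0 \<^bold>= Suc x \<^bold>\<or> 0 \<^bold>= Suc y))"

text \<open>\<open>z = (x, y) = {{x}, {x, y}}\<close>\<close>
definition pair_fm :: "nat \<Rightarrow> nat \<Rightarrow> nat \<Rightarrow> fm"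
  where "pair_fm x y z =
    (\<^bold>\<exists>\<^bold>\<exists>(upair_fm (x + 2) (x + 2) 1 \<^bold>\<and> upair_fm (x + 2) (y + 2) 0 \<^bold>\<and> upair_fm 1 0 (z + 2)))"

text \<open>\<open>y = x \<union> {x}\<close>\<close>
definition succ_fm :: "nat \<Rightarrow> nat \<Rightarrow> fm"
  where "succ_fm x y = (\<^bold>\<forall>(0 \<^bold>\<in> Suc y \<^bold>\<longleftrightarrow> 0 \<^bold>\<in> Suc x \<^bold>\<or> 0 \<^bold>= Suc x))"

definition inductive_fm :: "nat \<Rightarrow> fm"
  where "inductive_fm w =
    ((\<^bold>\<exists>\<in>w. empty_fm 0) \<^bold>\<and> (\<^bold>\<forall>\<in>w. \<^bold>\<exists>\<in>Suc w. succ_fm 1 0))"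

text \<open>Natural numbers are the elements of all inductive sets (finite von Neumann ordinals).\<close>
definition nat_fm :: "nat \<Rightarrow> fm"
  where "nat_fm n = (\<^bold>\<forall>(inductive_fm 0 \<^bold>\<longrightarrow> Suc n \<^bold>\<in> 0))"

text \<open>\<open>2 \<le> n\<close>; the three bound variables are \<open>0\<close>, \<open>1\<close> and \<open>2\<close>, in this order.\<close>
definition ge_two_fm :: "nat \<Rightarrow> fm"
  where "ge_two_fm n =
    (\<^bold>\<exists>\<^bold>\<exists>\<^bold>\<exists>(empty_fm 2 \<^bold>\<and> succ_fm 2 1 \<^bold>\<and> succ_fm 1 0 \<^bold>\<and> (0 \<^bold>\<in> n + 3 \<^bold>\<or> 0 \<^bold>= n + 3)))"

text \<open>\<open>(x, y) \<in> f\<close>\<close>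
definition app_fm :: "nat \<Rightarrow> nat \<Rightarrow> nat \<Rightarrow> fm"
  where "app_fm f x y = (\<^bold>\<exists>\<in>f. pair_fm (Suc x) (Suc y) 0)"

text \<open>\<open>f : A \<rightarrow> B\<close>\<close>
definition function_fm :: "nat \<Rightarrow> nat \<Rightarrow> nat \<Rightarrow> fm"
  where "function_fm f A B =
    ((\<^bold>\<forall>\<in>f. \<^bold>\<exists>\<in>A + 1. \<^bold>\<exists>\<in>B + 2. pair_fm 1 0 2) \<^bold>\<and>
     (\<^bold>\<forall>\<in>A. \<^bold>\<exists>(app_fm (f + 2) 1 0 \<^bold>\<and> (\<^bold>\<forall>(app_fm (f + 3) 2 0 \<^bold>\<longrightarrow> 0 \<^bold>= 1)))))"

definition bijection_fm :: "nat \<Rightarrow> nat \<Rightarrow> nat \<Rightarrow> fm"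
  where "bijection_fm f A B =
    (function_fm f A B \<^bold>\<and>
     (\<^bold>\<forall>\<in>A. \<^bold>\<forall>\<in>A + 1. \<^bold>\<forall>(app_fm (f + 3) 2 0 \<^bold>\<and> app_fm (f + 3) 1 0 \<^bold>\<longrightarrow> 2 \<^bold>= 1)) \<^bold>\<and>
     (\<^bold>\<forall>\<in>B. \<^bold>\<exists>\<in>A + 1. app_fm (f + 2) 0 1))"


subsection \<open>The axioms of ZF\<close>

definition extensionality_ax :: fm
  where "extensionality_ax = (\<^bold>\<forall>\<^bold>\<forall>((\<^bold>\<forall>(0 \<^bold>\<in> 2 \<^bold>\<longleftrightarrow> 0 \<^bold>\<in> 1)) \<^bold>\<longrightarrow> 1 \<^bold>= 0))"

definition foundation_ax :: fm
  where "foundation_ax =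
    (\<^bold>\<forall>((\<^bold>\<exists>0 \<^bold>\<in> 1) \<^bold>\<longrightarrow> (\<^bold>\<exists>\<in>0. \<^bold>\<not> (\<^bold>\<exists>(0 \<^bold>\<in> 1 \<^bold>\<and> 0 \<^bold>\<in> 2)))))"

definition pairing_ax :: fm
  where "pairing_ax = (\<^bold>\<forall>\<^bold>\<forall>\<^bold>\<exists>upair_fm 2 1 0)"

definition union_ax :: fm
  where "union_ax = (\<^bold>\<forall>\<^bold>\<exists>\<^bold>\<forall>(0 \<^bold>\<in> 1 \<^bold>\<longleftrightarrow> (\<^bold>\<exists>\<in>2. 1 \<^bold>\<in> 0)))"

definition power_ax :: fm
  where "power_ax = (\<^bold>\<forall>\<^bold>\<exists>\<^bold>\<forall>(0 \<^bold>\<in> 1 \<^bold>\<longleftrightarrow> subset_fm 0 2))"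

definition infinity_ax :: fm
  where "infinity_ax = (\<^bold>\<exists>inductive_fm 0)"

text \<open>
  \<open>\<forall>a. \<exists>b. \<forall>x. x \<in> b \<longleftrightarrow> x \<in> a \<and> p(x, a, \<dots>)\<close>, where in \<open>p\<close> the variable \<open>0\<close> stands for \<open>x\<close>,
  \<open>1\<close> for \<open>a\<close>, and the remaining ones are parameters; the renaming makes \<open>p\<close> skip \<open>b\<close>.
\<close>
definition separation_ax :: "fm \<Rightarrow> fm"
  where "separation_ax p = (\<^bold>\<forall>\<^bold>\<exists>\<^bold>\<forall>(0 \<^bold>\<in> 1 \<^bold>\<longleftrightarrow> 0 \<^bold>\<in> 2 \<^bold>\<and> ren (up Suc) p))"

text \<open>
  \<open>\<forall>a. (\<forall>y z. \<forall>x \<in> a. p(x, y, a, \<dots>) \<and> p(x, z, a, \<dots>) \<longrightarrow> y = z) \<longrightarrow>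
  (\<exists>b. \<forall>y. y \<in> b \<longleftrightarrow> (\<exists>x \<in> a. p(x, y, a, \<dots>)))\<close>, where in \<open>p\<close> the variables \<open>0\<close>, \<open>1\<close>, \<open>2\<close> stand
  for the three displayed arguments, and the remaining ones are parameters.
\<close>
definition replacement_ax :: "fm \<Rightarrow> fm"
  where "replacement_ax p =
    (\<^bold>\<forall>((\<^bold>\<forall>\<^bold>\<forall>\<^bold>\<forall>\<in>2. (ren (up Suc) p \<^bold>\<and> ren (up (up Suc)) p \<^bold>\<longrightarrow> 2 \<^bold>= 1)) \<^bold>\<longrightarrow>
       (\<^bold>\<exists>\<^bold>\<forall>(0 \<^bold>\<in> 1 \<^bold>\<longleftrightarrow> (\<^bold>\<exists>\<in>2. ren (up (up Suc)) p)))))"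

text \<open>The schemas are closed by universally quantifying over all parameters.\<close>
definition closures :: "fm \<Rightarrow> fm set"
  where "closures p = {(All ^^ k) p | k. fv p \<subseteq> {..<k}}"

definition ZF :: "fm set"
  where "ZF =
    {extensionality_ax, foundation_ax, pairing_ax, union_ax, power_ax, infinity_ax} \<union>
    (\<Union>p. closures (separation_ax p)) \<union> (\<Union>p. closures (replacement_ax p))"


subsection \<open>Graphs and the two choice principles\<close>

text \<open>A graph is a vertex set \<open>V\<close> with a set \<open>E\<close> of two-element subsets of \<open>V\<close>.\<close>
definition graph_fm :: "nat \<Rightarrow> nat \<Rightarrow> fm"
  where "graph_fm V E =
    (\<^bold>\<forall>\<in>E. \<^bold>\<exists>\<in>V + 1. \<^bold>\<exists>\<in>V + 2. (\<^bold>\<not> 1 \<^bold>= 0 \<^bold>\<and> upair_fm 1 0 2))"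

definition adjacent_fm :: "nat \<Rightarrow> nat \<Rightarrow> nat \<Rightarrow> fm"
  where "adjacent_fm E x y = (\<^bold>\<exists>\<in>E. upair_fm (Suc x) (Suc y) 0)"

text \<open>
  There is a walk \<open>f(0), \<dots>, f(k)\<close> from \<open>x\<close> to \<open>y\<close>, i.e. a natural number \<open>k\<close>, with successor \<open>s\<close>,
  and a function \<open>f : s \<rightarrow> V\<close> such that \<open>f(0) = x\<close>, \<open>f(k) = y\<close> and \<open>f(i)\<close>, \<open>f(i + 1)\<close> are
  adjacent for all \<open>i \<in> k\<close>. Below the three outer binders, \<open>f\<close>, \<open>s\<close>, \<open>k\<close> are \<open>0\<close>, \<open>1\<close>, \<open>2\<close>.
\<close>
definition walk_fm :: "nat \<Rightarrow> nat \<Rightarrow> nat \<Rightarrow> nat \<Rightarrow> fm"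
  where "walk_fm V E x y =
    (\<^bold>\<exists>\<^bold>\<exists>\<^bold>\<exists>(nat_fm 2 \<^bold>\<and> succ_fm 2 1 \<^bold>\<and> function_fm 0 1 (V + 3) \<^bold>\<and>
      (\<^bold>\<exists>(empty_fm 0 \<^bold>\<and> app_fm 1 0 (x + 4))) \<^bold>\<and>
      app_fm 0 2 (y + 3) \<^bold>\<and>
      (\<^bold>\<forall>\<in>2. \<^bold>\<exists>\<^bold>\<exists>\<^bold>\<exists>(succ_fm 3 2 \<^bold>\<and> app_fm 4 3 1 \<^bold>\<and> app_fm 4 2 0 \<^bold>\<and> adjacent_fm (E + 7) 1 0))))"

text \<open>\<open>C\<close> is (the vertex set of) a connected component: all vertices joined to some vertex by a walk.\<close>
definition component_fm :: "nat \<Rightarrow> nat \<Rightarrow> nat \<Rightarrow> fm"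
  where "component_fm V E C =
    (\<^bold>\<exists>\<in>V. \<^bold>\<forall>(0 \<^bold>\<in> C + 2 \<^bold>\<longleftrightarrow> 0 \<^bold>\<in> V + 2 \<^bold>\<and> walk_fm (V + 2) (E + 2) 1 0))"

text \<open>
  The subgraph induced on \<open>C\<close> is isomorphic to \<open>K\<^sub>n\<close>, taken as the graph on the vertex set
  \<open>n = {0, \<dots>, n - 1}\<close> in which any two different vertices are adjacent.
\<close>
definition iso_complete_fm :: "nat \<Rightarrow> nat \<Rightarrow> nat \<Rightarrow> fm"
  where "iso_complete_fm n E C =
    (\<^bold>\<exists>(bijection_fm 0 (n + 1) (C + 1) \<^bold>\<and>
      (\<^bold>\<forall>\<in>n + 1. \<^bold>\<forall>\<in>n + 2. \<^bold>\<forall>\<^bold>\<forall>(app_fm 4 3 1 \<^bold>\<and> app_fm 4 2 0 \<^bold>\<longrightarrow>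
        (\<^bold>\<not> 3 \<^bold>= 2 \<^bold>\<longleftrightarrow> adjacent_fm (E + 5) 1 0)))))"

definition independent_fm :: "nat \<Rightarrow> nat \<Rightarrow> nat \<Rightarrow> fm"
  where "independent_fm V E I =
    (subset_fm I V \<^bold>\<and> (\<^bold>\<forall>\<in>I. \<^bold>\<forall>\<in>I + 1. \<^bold>\<not> adjacent_fm (E + 2) 1 0))"

definition max_independent_fm :: "nat \<Rightarrow> nat \<Rightarrow> nat \<Rightarrow> fm"
  where "max_independent_fm V E I =
    (independent_fm V E I \<^bold>\<and>
     \<^bold>\<not> (\<^bold>\<exists>(independent_fm (V + 1) (E + 1) 0 \<^bold>\<and> subset_fm (I + 1) 0 \<^bold>\<and> \<^bold>\<not> I + 1 \<^bold>= 0)))"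

text \<open>The principle \<open>\<P>\<^sub>n\<close>.\<close>
definition P_fm :: "nat \<Rightarrow> fm"
  where "P_fm n =
    (\<^bold>\<forall>\<^bold>\<forall>(graph_fm 1 0 \<^bold>\<and> (\<^bold>\<forall>(component_fm 2 1 0 \<^bold>\<longrightarrow> iso_complete_fm (n + 3) 1 0)) \<^bold>\<longrightarrow>
      (\<^bold>\<exists>max_independent_fm 2 1 0)))"

text \<open>
  The principle \<open>AC\<^sub>n\<close>: for every set \<open>F\<close> of \<open>n\<close>-element sets there is a function \<open>c : F \<rightarrow> U\<close>, for
  some \<open>U\<close>, with \<open>c(A) \<in> A\<close> for all \<open>A \<in> F\<close>.
\<close>
definition AC_fm :: "nat \<Rightarrow> fm"
  where "AC_fm n =
    (\<^bold>\<forall>((\<^bold>\<forall>\<in>0. \<^bold>\<exists>bijection_fm 0 (n + 3) 1) \<^bold>\<longrightarrow>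
       (\<^bold>\<exists>\<^bold>\<exists>(function_fm 1 2 0 \<^bold>\<and> (\<^bold>\<forall>\<in>2. \<^bold>\<exists>\<in>0. app_fm 3 1 0)))))"

end

theory Submission
  imports Defs "HOL-Library.Countable_Set"
begin

text \<open>
  By Goedel's completeness theorem it suffices to argue in an arbitrary model of ZF. There the proof
  uses only separation, pairing, union, power set, infinity and foundation.

  Given \<open>AC\<^sub>n\<close> and a graph whose components are complete of size \<open>n\<close>, choose one vertex from each
  component. Components are cliques closed under adjacency, so the chosen vertices form a maximal
  independent set. Given \<open>\<P>\<^sub>n\<close> and a family \<open>F\<close> of \<open>n\<close>-element sets, let the graph have vertices
  \<open>(A, a)\<close> with \<open>a \<in> A \<in> F\<close> and edges between different vertices with the same first coordinate. By
  induction along walks its components are the sets \<open>{A} \<times> A\<close>, and a maximal independent set is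
  literally a choice function on \<open>F\<close>.
\<close>

section \<open>Renaming\<close>

lemma up_comp: "up r (up s n) = up (r \<circ> s) n"
  by (cases n) auto

lemma ren_cong: "(\<And>n. n \<in> fv p \<Longrightarrow> r n = s n) \<Longrightarrow> ren r p = ren s p"
proof (induction p arbitrary: r s)
  case (All p)
  have "up r n = up s n" if "n \<in> fv p" for n
    using that All.prems by (cases n) auto
  then have "ren (up r) p = ren (up s) p" by (rule All.IH)
  then show ?case by simp
next
  case (Imp p q)
  then show ?case by (metis Un_iff fv.simps(4) ren.simps(4))
qed auto

lemma ren_ren: "ren r (ren s p) = ren (r \<circ> s) p"
proof (induction p arbitrary: r s)
  case (All p)
  then show ?case by (simp add: up_comp comp_def)
qed auto

lemma up_id: "up (\<lambda>n. n) = (\<lambda>n. n)"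
proof
  show "up (\<lambda>n. n) n = n" for n by (cases n) auto
qed

lemma ren_id: "ren (\<lambda>n. n) p = p"
  by (induction p) (auto simp: up_id)

lemma ren_inst: "ren r (inst x p) = inst (r x) (ren (up r) p)"
proof -
  have "(r \<circ> case_nat x (\<lambda>n. n)) n = (case_nat (r x) (\<lambda>n. n) \<circ> up r) n" for n
    by (cases n) auto
  then show ?thesis by (auto simp: inst_def ren_ren intro: ren_cong)
qed

text \<open>Syntactic counterpart of the clause for \<open>All\<close> in \<open>sat\<close>:
  instantiating a lifted renaming extends it by the value \<open>x\<close>. The quantifier case of
  the truth lemma rests on it.\<close>

lemma inst_ren_up: "inst x (ren (up r) p) = ren (case_nat x r) p"
proof -
  have "(case_nat x (\<lambda>n. n) \<circ> up r) n = case_nat x r n" for n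
    by (cases n) auto
  then show ?thesis by (auto simp: inst_def ren_ren intro: ren_cong)
qed

lemma ren_Neg: "ren r (\<^bold>\<not> p) = (\<^bold>\<not> ren r p)"
  by (simp add: Neg_def)

lemma finite_fv: "finite (fv p)"
proof (induction p)
  case (All p)
  have "Suc ` fv (\<^bold>\<forall>p) \<subseteq> fv p" by auto
  then show ?case using All finite_subset by (metis finite_imageD inj_Suc)
qed auto

lemma fv_All_pow: "fv ((All ^^ k) p) = {n. n + k \<in> fv p}"
  by (induction k) auto


section \<open>Derivations\<close>

lemma weaken: "\<Gamma> \<turnstile> p \<Longrightarrow> \<Gamma> \<subseteq> \<Delta> \<Longrightarrow> \<Delta> \<turnstile> p"
proof (induction arbitrary: \<Delta> rule: derives.induct)
  case (ImpI p \<Gamma> q)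
  then show ?case by (meson derives.ImpI insert_mono)
next
  case (Contr p \<Gamma>)
  then show ?case by (meson derives.Contr insert_mono)
next
  case (AllI \<Gamma> p)
  then show ?case by (meson derives.AllI image_mono)
next
  case (EqSubst \<Gamma> x y p)
  then show ?case by (intro derives.EqSubst[of \<Delta> x y p]) auto
next
  case (AllE \<Gamma> p x)
  then show ?case by (intro derives.AllE) auto
qed (auto intro: Assm ImpE EqRefl)

text \<open>Derivations are finite objects. In the Henkin construction an inconsistency of the limit
  therefore already occurs at a finite stage.\<close>

lemma compact: "\<Gamma> \<turnstile> p \<Longrightarrow> \<exists>\<Delta>. finite \<Delta> \<and> \<Delta> \<subseteq> \<Gamma> \<and> (\<Delta> \<turnstile> p)"
proof (induction rule: derives.induct)
  case (Assm p \<Gamma>)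
  then have "finite {p}" "{p} \<subseteq> \<Gamma>" "{p} \<turnstile> p" by (auto intro: derives.Assm)
  then show ?case by blast
next
  case (ImpI p \<Gamma> q)
  then obtain \<Delta> where "finite \<Delta>" "\<Delta> \<subseteq> insert p \<Gamma>" "\<Delta> \<turnstile> q" by blast
  then have "finite (\<Delta> - {p})" "\<Delta> - {p} \<subseteq> \<Gamma>" "insert p (\<Delta> - {p}) \<turnstile> q"
    by (auto elim!: weaken)
  then show ?case by (meson derives.ImpI)
next
  case (ImpE \<Gamma> p q)
  then obtain \<Delta> \<Delta>' where "finite \<Delta>" "\<Delta> \<subseteq> \<Gamma>" "\<Delta> \<turnstile> p \<^bold>\<longrightarrow> q"
    "finite \<Delta>'" "\<Delta>' \<subseteq> \<Gamma>" "\<Delta>' \<turnstile> p" by blast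
  then have "finite (\<Delta> \<union> \<Delta>')" "\<Delta> \<union> \<Delta>' \<subseteq> \<Gamma>" "\<Delta> \<union> \<Delta>' \<turnstile> q"
    by (auto intro!: derives.ImpE[of _ p q] elim!: weaken)
  then show ?case by blast
next
  case (Contr p \<Gamma>)
  then obtain \<Delta> where "finite \<Delta>" "\<Delta> \<subseteq> insert (\<^bold>\<not> p) \<Gamma>" "\<Delta> \<turnstile> Bot" by blast
  then have "finite (\<Delta> - {\<^bold>\<not> p})" "\<Delta> - {\<^bold>\<not> p} \<subseteq> \<Gamma>" "insert (\<^bold>\<not> p) (\<Delta> - {\<^bold>\<not> p}) \<turnstile> Bot"
    by (auto elim!: weaken)
  then show ?case by (meson derives.Contr)
next
  case (AllI \<Gamma> p)
  then obtain \<Delta> where "finite \<Delta>" "\<Delta> \<subseteq> ren Suc ` \<Gamma>" "\<Delta> \<turnstile> p" by blast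
  then obtain \<Delta>' where "\<Delta>' \<subseteq> \<Gamma>" "finite \<Delta>'" "\<Delta> = ren Suc ` \<Delta>'"
    by (meson finite_subset_image)
  then show ?case using \<open>\<Delta> \<turnstile> p\<close> derives.AllI by blast
next
  case (AllE \<Gamma> p x)
  then show ?case by (meson derives.AllE)
next
  case (EqRefl \<Gamma> x)
  then show ?case using derives.EqRefl by blast
next
  case (EqSubst \<Gamma> x y p)
  then obtain \<Delta> \<Delta>' where "finite \<Delta>" "\<Delta> \<subseteq> \<Gamma>" "\<Delta> \<turnstile> x \<^bold>= y"
    "finite \<Delta>'" "\<Delta>' \<subseteq> \<Gamma>" "\<Delta>' \<turnstile> inst x p" by blast
  then have "finite (\<Delta> \<union> \<Delta>')" "\<Delta> \<union> \<Delta>' \<subseteq> \<Gamma>" "\<Delta> \<union> \<Delta>' \<turnstile> inst y p"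
    by (auto intro!: derives.EqSubst[of _ x y p] elim!: weaken)
  then show ?case by blast
qed

text \<open>The quantifier rule is preserved because a lifted renaming commutes with the shift of
  the context.\<close>

lemma derives_ren: "\<Gamma> \<turnstile> p \<Longrightarrow> ren r ` \<Gamma> \<turnstile> ren r p"
proof (induction arbitrary: r rule: derives.induct)
  case (AllI \<Gamma> p)
  have "ren (up r) ` ren Suc ` \<Gamma> = ren Suc ` ren r ` \<Gamma>"
    by (auto simp: image_image ren_ren comp_def)
  then show ?case using AllI.IH[of "up r"] by (auto intro: derives.AllI)
next
  case (AllE \<Gamma> p x)
  then show ?case using derives.AllE[of "ren r ` \<Gamma>" "ren (up r) p" "r x"] by (simp add: ren_inst)
next
  case (EqSubst \<Gamma> x y p)
  then show ?case
    using derives.EqSubst[of "ren r ` \<Gamma>" "r x" "r y" "ren (up r) p"] by (simp add: ren_inst)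
qed (auto simp: ren_Neg intro: Assm ImpI ImpE Contr EqRefl)

text \<open>Links the eigenvariable condition to the de Bruijn rule \<open>AllI\<close>: renaming
  \<open>y\<close> to \<open>0\<close> and shifting all other variables acts on
  \<open>\<Gamma>\<close> as the shift that \<open>AllI\<close> demands, and undoes the
  instantiation of \<open>p\<close>.\<close>

lemma generalize:
  assumes "\<Gamma> \<turnstile> inst y p" and "\<And>q. q \<in> \<Gamma> \<Longrightarrow> y \<notin> fv q" and "y \<notin> fv (\<^bold>\<forall>p)"
  shows "\<Gamma> \<turnstile> (\<^bold>\<forall>p)"
proof -
  define r where "r = (\<lambda>n. if n = y then 0 else Suc n)"
  have "ren r q = ren Suc q" if "q \<in> \<Gamma>" for q
    by (rule ren_cong) (use assms(2) that in \<open>auto simp: r_def\<close>)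
  then have G: "ren r ` \<Gamma> = ren Suc ` \<Gamma>" by simp
  have "(r \<circ> case_nat y (\<lambda>n. n)) n = n" if "n \<in> fv p" for n
    using that assms(3) by (cases n) (auto simp: r_def)
  then have "ren r (inst y p) = ren (\<lambda>n. n) p"
    unfolding inst_def ren_ren by (intro ren_cong)
  then show ?thesis
    using derives_ren[OF assms(1), of r] by (auto simp: G ren_id intro: AllI)
qed


section \<open>Completeness\<close>

text \<open>Equality is interpreted by a congruence \<open>Q\<close> because the points of a Henkin model are variables,
  several of which may be provably equal.\<close>
fun sat :: "('a \<Rightarrow> 'a \<Rightarrow> bool) \<Rightarrow> ('a \<Rightarrow> 'a \<Rightarrow> bool) \<Rightarrow> (nat \<Rightarrow> 'a) \<Rightarrow> fm \<Rightarrow> bool" where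
  "sat Q M e (x \<^bold>\<in> y) = M (e x) (e y)"
| "sat Q M e (x \<^bold>= y) = Q (e x) (e y)"
| "sat Q M e Bot = False"
| "sat Q M e (p \<^bold>\<longrightarrow> q) = (sat Q M e p \<longrightarrow> sat Q M e q)"
| "sat Q M e (\<^bold>\<forall>p) = (\<forall>a. sat Q M (case_nat a e) p)"

definition mem_congruence :: "('a \<Rightarrow> 'a \<Rightarrow> bool) \<Rightarrow> ('a \<Rightarrow> 'a \<Rightarrow> bool) \<Rightarrow> bool" where
  "mem_congruence Q M \<longleftrightarrow> equivp Q \<and> (\<forall>x x' y y'. Q x x' \<longrightarrow> Q y y' \<longrightarrow> M x y \<longrightarrow> M x' y')"

instance fm :: countable
  by countable_datatype

section \<open>Henkin extensions and the term model\<close>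

text \<open>One stage: \<open>q\<close> is added if that is consistent, and with it a witness if
  \<open>q\<close> denies a universal formula. Variables serve as witnesses in place of new
  constants, so only finitely many may be free, to leave a fresh one.\<close>

lemma henkin_step:
  assumes "\<not> (S \<turnstile> Bot)" and "finite (\<Union>(fv ` S))"
  shows "\<exists>S'. S \<subseteq> S' \<and> \<not> (S' \<turnstile> Bot) \<and> finite (\<Union>(fv ` S')) \<and>
    (q \<in> S' \<or> (insert q S \<turnstile> Bot)) \<and> (\<forall>p. q = (\<^bold>\<not> (\<^bold>\<forall>p)) \<longrightarrow> q \<in> S' \<longrightarrow> (\<exists>y. (\<^bold>\<not> inst y p) \<in> S'))"
proof (cases "insert q S \<turnstile> Bot")
  case True
  have "q \<notin> S" using True assms(1) by (auto simp: insert_absorb)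
  then show ?thesis using True assms by blast
next
  case False
  have fin: "finite (\<Union>(fv ` insert q S))" using assms(2) by (simp add: finite_fv)
  show ?thesis
  proof (cases "\<exists>p. q = (\<^bold>\<not> (\<^bold>\<forall>p))")
    case True
    then obtain p where p: "q = (\<^bold>\<not> (\<^bold>\<forall>p))" by blast
    obtain y where y: "y \<notin> \<Union>(fv ` insert q S)" using ex_new_if_finite[OF infinite_UNIV_nat fin] by blast
    let ?S = "insert (\<^bold>\<not> inst y p) (insert q S)"
    have "\<not> (?S \<turnstile> Bot)"
    proof
      assume "?S \<turnstile> Bot"
      then have "insert q S \<turnstile> inst y p" by (rule Contr)
      moreover have "y \<notin> fv (\<^bold>\<forall>p)" using y by (auto simp: p Neg_def)
      ultimately have "insert q S \<turnstile> (\<^bold>\<forall>p)" using y by (intro generalize) auto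
      moreover have "insert q S \<turnstile> (\<^bold>\<forall>p) \<^bold>\<longrightarrow> Bot" by (rule Assm) (simp add: p Neg_def)
      ultimately show False using False ImpE by blast
    qed
    moreover have "finite (\<Union>(fv ` ?S))" using fin by (simp add: finite_fv)
    moreover have "\<exists>y. (\<^bold>\<not> inst y p') \<in> ?S" if "q = (\<^bold>\<not> (\<^bold>\<forall>p'))" for p'
      using that by (auto simp: p Neg_def)
    ultimately show ?thesis by (intro exI[of _ ?S]) blast
  next
    case no: False
    show ?thesis by (rule exI[of _ "insert q S"]) (use False fin no in blast)
  qed
qed

text \<open>Dependent choice iterates \<open>henkin_step\<close> along an enumeration of all
  formulas; the union stays consistent by compactness.\<close>

lemma henkin_extension:
  assumes "\<not> (S \<turnstile> Bot)" and "finite (\<Union>(fv ` S))"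
  obtains H where "S \<subseteq> H" "\<not> (H \<turnstile> Bot)" "\<And>q. q \<in> H \<or> (insert q H \<turnstile> Bot)"
    "\<And>p. (\<^bold>\<not> (\<^bold>\<forall>p)) \<in> H \<Longrightarrow> \<exists>y. (\<^bold>\<not> inst y p) \<in> H"
proof -
  define R where "R = (\<lambda>n (T::fm set) T'. T \<subseteq> T' \<and> (from_nat n \<in> T' \<or> (insert (from_nat n) T \<turnstile> Bot)) \<and>
    (\<forall>p. from_nat n = (\<^bold>\<not> (\<^bold>\<forall>p)) \<longrightarrow> from_nat n \<in> T' \<longrightarrow> (\<exists>y. (\<^bold>\<not> inst y p) \<in> T')))"
  define P where "P = (\<lambda>n::nat. \<lambda>T. S \<subseteq> T \<and> \<not> (T \<turnstile> Bot) \<and> finite (\<Union>(fv ` T)))"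
  have "\<exists>f. \<forall>n. P n (f n) \<and> R n (f n) (f (Suc n))"
  proof (rule dependent_nat_choice)
    show "\<exists>T. P 0 T" using assms by (auto simp: P_def)
    show "\<exists>T'. P (Suc n) T' \<and> R n T T'" if "P n T" for T n
    proof -
      have T: "S \<subseteq> T" "\<not> (T \<turnstile> Bot)" "finite (\<Union>(fv ` T))" using that by (auto simp: P_def)
      obtain T' where T': "T \<subseteq> T'" "\<not> (T' \<turnstile> Bot)" "finite (\<Union>(fv ` T'))"
        "from_nat n \<in> T' \<or> (insert (from_nat n) T \<turnstile> Bot)"
        "\<forall>p. from_nat n = (\<^bold>\<not> (\<^bold>\<forall>p)) \<longrightarrow> from_nat n \<in> T' \<longrightarrow> (\<exists>y. (\<^bold>\<not> inst y p) \<in> T')"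
        using henkin_step[OF T(2,3), of "from_nat n"] by (elim exE conjE)
      have "P (Suc n) T'" unfolding P_def by (intro conjI T' order_trans[OF T(1)])
      moreover have "R n T T'" unfolding R_def by (intro conjI T')
      ultimately show ?thesis by blast
    qed
  qed
  then obtain f where P: "\<And>n. P n (f n)" and R: "\<And>n. R n (f n) (f (Suc n))" by blast
  have mono: "f m \<subseteq> f n" if "m \<le> n" for m n
    by (rule lift_Suc_mono_le[OF _ that]) (use R in \<open>simp add: R_def\<close>)
  let ?H = "\<Union>n. f n"
  have cons: "\<not> (?H \<turnstile> Bot)"
  proof
    assume "?H \<turnstile> Bot"
    then obtain D where D: "finite D" "D \<subseteq> ?H" "D \<turnstile> Bot" using compact by blast
    have "\<exists>n. D \<subseteq> f n" using D(1,2)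
    proof (induction D)
      case (insert x D)
      then obtain m n where "x \<in> f m" "D \<subseteq> f n" by auto
      then have "insert x D \<subseteq> f (max m n)"
        using mono[of m "max m n"] mono[of n "max m n"] by auto
      then show ?case by blast
    qed simp
    then show False using D(3) P weaken unfolding P_def by blast
  qed
  show thesis
  proof (rule that[of ?H])
    show "S \<subseteq> ?H" using P by (auto simp: P_def)
    show "\<not> (?H \<turnstile> Bot)" by (rule cons)
    show "q \<in> ?H \<or> (insert q ?H \<turnstile> Bot)" for q
    proof -
      have "q \<in> f (Suc (to_nat q)) \<or> (insert q (f (to_nat q)) \<turnstile> Bot)"
        using R[of "to_nat q"] unfolding R_def by simp
      then show ?thesis
        using weaken[of "insert q (f (to_nat q))" Bot "insert q ?H"] by blast
    qed
    show "\<exists>y. (\<^bold>\<not> inst y p) \<in> ?H" if H: "(\<^bold>\<not> (\<^bold>\<forall>p)) \<in> ?H" for p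
    proof -
      let ?q = "\<^bold>\<not> (\<^bold>\<forall>p)"
      \<comment> \<open>Stage \<open>to_nat ?q\<close> decides \<open>?q\<close>. As a member of the
        consistent limit it was not refuted there, hence was added together with a witness.\<close>
      have "\<not> (insert ?q (f (to_nat ?q)) \<turnstile> Bot)"
        using cons H weaken[of "insert ?q (f (to_nat ?q))" Bot ?H] by blast
      then show ?thesis using R[of "to_nat ?q"] unfolding R_def from_nat_to_nat by blast
    qed
  qed
qed

text \<open>An assignment of variables to variables is a renaming, so the truth lemma of the Henkin model
  reads \<open>sat Q M e p \<longleftrightarrow> ren e p \<in> H\<close>.\<close>
theorem model_existence:
  assumes "\<not> (S \<turnstile> Bot)" and "finite (\<Union>(fv ` S))"
  obtains Q M :: "nat \<Rightarrow> nat \<Rightarrow> bool" where "mem_congruence Q M"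
    "\<And>p. p \<in> S \<Longrightarrow> sat Q M (\<lambda>n. n) p"
proof -
  obtain H where H: "S \<subseteq> H" "\<not> (H \<turnstile> Bot)" "\<And>q. q \<in> H \<or> (insert q H \<turnstile> Bot)"
    "\<And>p. (\<^bold>\<not> (\<^bold>\<forall>p)) \<in> H \<Longrightarrow> \<exists>y. (\<^bold>\<not> inst y p) \<in> H"
    using henkin_extension[OF assms] by metis
  have ded: "q \<in> H" if "H \<turnstile> q" for q
    using H(2,3) that ImpI ImpE by blast
  have neg: "q \<notin> H \<longleftrightarrow> (\<^bold>\<not> q) \<in> H" for q
  proof
    show "(\<^bold>\<not> q) \<in> H" if "q \<notin> H"
      using that H(3) ded[OF ImpI] by (auto simp: Neg_def)
    show "q \<notin> H" if "(\<^bold>\<not> q) \<in> H"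
      using that H(2) ImpE[of H q Bot] Assm[of _ H] by (auto simp: Neg_def)
  qed
  define Q where "Q = (\<lambda>x y. (x \<^bold>= y) \<in> H)"
  define M where "M = (\<lambda>x y. (x \<^bold>\<in> y) \<in> H)"
  have subst: "inst y p \<in> H" if "Q x y" "inst x p \<in> H" for x y p
    using that unfolding Q_def by (meson ded EqSubst Assm)
  have refl: "Q x x" for x by (simp add: Q_def ded EqRefl)
  \<comment> \<open>This and the next two facts each substitute in an atomic formula. Reflexivity
    with the Euclidean law makes \<open>Q\<close> an equivalence.\<close>
  have eucl: "Q y z" if "Q x y" "Q x z" for x y z
    using subst[OF that(1), of "0 \<^bold>= Suc z"] that(2) by (simp add: Q_def inst_def)
  have left: "M y z" if "Q x y" "M x z" for x y z
    using subst[OF that(1), of "0 \<^bold>\<in> Suc z"] that(2) by (simp add: M_def inst_def)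
  have right: "M z y" if "Q x y" "M z x" for x y z
    using subst[OF that(1), of "Suc z \<^bold>\<in> 0"] that(2) by (simp add: M_def inst_def)
  have truth: "sat Q M e p \<longleftrightarrow> ren e p \<in> H" for e p
  proof (induction p arbitrary: e)
    case Bot
    then show ?case using H(2) Assm by auto
  next
    case (Imp p q)
    have "ren e q \<in> H" if "(ren e p \<^bold>\<longrightarrow> ren e q) \<in> H" "ren e p \<in> H"
      using that by (meson Assm ImpE ded)
    moreover have "(ren e p \<^bold>\<longrightarrow> ren e q) \<in> H" if "ren e q \<in> H"
      using that by (auto intro: ded ImpI Assm)
    moreover have "(ren e p \<^bold>\<longrightarrow> ren e q) \<in> H" if "ren e p \<notin> H"
    proof -
      have "insert (ren e p) H \<turnstile> Bot" using that H(3) by blast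
      then have "insert (\<^bold>\<not> ren e q) (insert (ren e p) H) \<turnstile> Bot" by (rule weaken) auto
      then have "insert (ren e p) H \<turnstile> ren e q" by (rule Contr)
      then show ?thesis by (auto intro: ded ImpI)
    qed
    ultimately show ?case using Imp by auto
  next
    case (All p)
    let ?q = "ren (up e) p"
    \<comment> \<open>Left to right is \<open>AllE\<close>. Right to left uses the witnesses: a
      universal formula outside \<open>H\<close> has its negation in \<open>H\<close>.\<close>
    have "(\<^bold>\<forall>?q) \<in> H \<longleftrightarrow> (\<forall>x. inst x ?q \<in> H)"
      using H(4)[of ?q] neg by (meson AllE Assm ded)
    then show ?case using All by (simp add: inst_ren_up)
  qed (auto simp: Q_def M_def)
  show thesis
  proof (rule that)
    have "equivp Q" by (intro equivpI reflpI sympI transpI) (use refl eucl in blast)+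
    then show "mem_congruence Q M" using left right unfolding mem_congruence_def by blast
    show "sat Q M (\<lambda>n. n) p" if "p \<in> S" for p
      using that H(1) by (auto simp: truth ren_id)
  qed
qed

section \<open>Models of ZF\<close>

lemma sat_cong: "(\<And>n. n \<in> fv p \<Longrightarrow> e n = e' n) \<Longrightarrow> sat Q M e p = sat Q M e' p"
proof (induction p arbitrary: e e')
  case (All p)
  have "sat Q M (case_nat a e) p = sat Q M (case_nat a e') p" for a
    by (rule All.IH) (use All.prems in \<open>auto split: nat.split\<close>)
  then show ?case by simp
next
  case (Imp p q)
  have "sat Q M e p = sat Q M e' p" by (rule Imp.IH) (simp add: Imp.prems)
  moreover have "sat Q M e q = sat Q M e' q" by (rule Imp.IH) (simp add: Imp.prems)
  ultimately show ?case by simp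
qed auto

lemma sat_ren: "sat Q M e (ren r p) = sat Q M (\<lambda>n. e (r n)) p"
proof (induction p arbitrary: e r)
  case (All p)
  have "(\<lambda>n. case_nat a e (up r n)) = case_nat a (\<lambda>n. e (r n))" for a
  proof
    show "case_nat a e (up r n) = case_nat a (\<lambda>n. e (r n)) n" for n by (cases n) auto
  qed
  then show ?case using All by simp
qed auto

text \<open>The outermost binder of \<open>(All ^^ Suc k) p\<close> governs variable
  \<open>k\<close> of \<open>p\<close>, so the induction instantiates it by \<open>f k\<close>
  first.\<close>

lemma sat_All_pow: "sat Q M e ((All ^^ k) p) \<Longrightarrow> sat Q M (\<lambda>n. if n < k then f n else e (n - k)) p"
proof (induction k arbitrary: e)
  case (Suc k)
  then have "sat Q M (case_nat (f k) e) ((All ^^ k) p)" by simp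
  then have "sat Q M (\<lambda>n. if n < k then f n else case_nat (f k) e (n - k)) p" by (rule Suc.IH)
  moreover have "(if n < k then f n else case_nat (f k) e (n - k)) =
      (if n < Suc k then f n else e (n - Suc k))" for n
    by (cases "n - k") (auto simp: less_Suc_eq,
      metis Suc_diff_Suc diff_Suc_Suc diff_diff_cancel diff_is_0_eq' le_antisym less_imp_le_nat not_le)
  ultimately show ?case by (simp only:)
qed simp

lemma sat_connectives [simp]:
  "sat Q M e (\<^bold>\<not> p) \<longleftrightarrow> \<not> sat Q M e p"
  "sat Q M e (p \<^bold>\<or> q) \<longleftrightarrow> sat Q M e p \<or> sat Q M e q"
  "sat Q M e (p \<^bold>\<and> q) \<longleftrightarrow> sat Q M e p \<and> sat Q M e q"
  "sat Q M e (p \<^bold>\<longleftrightarrow> q) \<longleftrightarrow> (sat Q M e p \<longleftrightarrow> sat Q M e q)"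
  "sat Q M e (\<^bold>\<exists>p) \<longleftrightarrow> (\<exists>a. sat Q M (case_nat a e) p)"
  "sat Q M e (\<^bold>\<forall>\<in>x. p) \<longleftrightarrow> (\<forall>a. M a (e x) \<longrightarrow> sat Q M (case_nat a e) p)"
  "sat Q M e (\<^bold>\<exists>\<in>x. p) \<longleftrightarrow> (\<exists>a. M a (e x) \<and> sat Q M (case_nat a e) p)"
  by (auto simp: Neg_def Or_def And_def Iff_def Ex_def BAll_def BEx_def)

lemma closed_closures: "q \<in> closures p \<Longrightarrow> fv q = {}"
  by (auto simp: closures_def fv_All_pow)

text \<open>Makes schema instances usable under every assignment: the quantifiers of a closure are
  instantiated by the values of \<open>e\<close> on the finitely many free variables.\<close>

lemma sat_closures:
  assumes "\<And>q. q \<in> closures p \<Longrightarrow> sat Q M e' q"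
  shows "sat Q M e p"
proof -
  obtain k where k: "fv p \<subseteq> {..<k}"
    using finite_fv[of p] finite_nat_bounded by blast
  then have "sat Q M e' ((All ^^ k) p)" by (intro assms) (auto simp: closures_def)
  then have "sat Q M (\<lambda>n. if n < k then e n else e' (n - k)) p" by (rule sat_All_pow)
  then show ?thesis using k by (subst sat_cong) auto
qed

lemma fv_connectives [simp]:
  "fv (\<^bold>\<not> p) = fv p"
  "fv (p \<^bold>\<or> q) = fv p \<union> fv q"
  "fv (p \<^bold>\<and> q) = fv p \<union> fv q"
  "fv (p \<^bold>\<longleftrightarrow> q) = fv p \<union> fv q"
  "fv (\<^bold>\<exists>p) = {n. Suc n \<in> fv p}"
  "fv (\<^bold>\<forall>\<in>x. p) = insert x {n. Suc n \<in> fv p}"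
  "fv (\<^bold>\<exists>\<in>x. p) = insert x {n. Suc n \<in> fv p}"
  by (auto simp: Neg_def Or_def And_def Iff_def Ex_def BAll_def BEx_def)

lemma closed_ZF: "q \<in> ZF \<Longrightarrow> fv q = {}"
  by (auto simp: ZF_def closed_closures extensionality_ax_def foundation_ax_def pairing_ax_def
      union_ax_def power_ax_def infinity_ax_def upair_fm_def subset_fm_def inductive_fm_def
      empty_fm_def succ_fm_def eval_nat_numeral)

section \<open>Infinitely many classes, and the quotient by equality\<close>

text \<open>With finitely many classes, pairing and union would assemble a universal set from
  representatives, which Russell's argument excludes.\<close>

lemma infinite_ZF_model:
  fixes Q :: "'a \<Rightarrow> 'a \<Rightarrow> bool"
  assumes cong: "mem_congruence Q M" and ZF: "\<And>p e. p \<in> ZF \<Longrightarrow> sat Q M e p"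
  shows "infinite (range Q)"
proof
  assume "finite (range Q)"
  then obtain A where A: "finite A" "range Q = Q ` A"
    by (metis finite_subset_image subset_UNIV subset_refl)
  have equiv: "equivp Q" using cong by (simp add: mem_congruence_def)
  have refl: "Q x x" for x using equiv equivp_reflp by fast
  have pairing: "\<exists>z. \<forall>w. M w z \<longleftrightarrow> Q w x \<or> Q w y" for x y
    using ZF[of pairing_ax] by (simp add: ZF_def pairing_ax_def upair_fm_def eval_nat_numeral)
  have union: "\<exists>z. \<forall>w. M w z \<longleftrightarrow> (\<exists>y. M y x \<and> M w y)" for x
    using ZF[of union_ax] by (simp add: ZF_def union_ax_def eval_nat_numeral)
  have "\<exists>u. \<forall>a\<in>A. M a u" using A(1)
  proof (induction A)
    case (insert a A)
    then obtain u where u: "\<forall>a\<in>A. M a u" by blast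
    obtain s where s: "\<And>w. M w s \<longleftrightarrow> Q w a \<or> Q w a" using pairing by blast
    obtain t where t: "\<And>w. M w t \<longleftrightarrow> Q w u \<or> Q w s" using pairing by blast
    obtain z where z: "\<And>w. M w z \<longleftrightarrow> (\<exists>y. M y t \<and> M w y)" using union by blast
    have "M b z" if "b \<in> insert a A" for b
      using that u s t z refl by blast
    then show ?case by blast
  qed simp
  then obtain u where u: "\<forall>a\<in>A. M a u" by blast
  have all: "M x u" for x
  proof -
    obtain a where "a \<in> A" "Q x = Q a" using A(2) by blast
    then have "Q a x" using equiv refl by metis
    then show ?thesis using u \<open>a \<in> A\<close> cong refl unfolding mem_congruence_def by blast
  qed
  have "sat Q M e (separation_ax (\<^bold>\<not> 0 \<^bold>\<in> 0))" for e
    by (rule sat_closures, rule ZF) (auto simp: ZF_def)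
  then have "\<forall>a. \<exists>b. \<forall>x. M x b \<longleftrightarrow> M x a \<and> \<not> M x x"
    by (simp add: separation_ax_def Neg_def eval_nat_numeral)
  then show False using all by blast
qed

text \<open>\<open>f\<close> is a quotient map onto a structure with true equality; surjectivity
  lets the quantifiers range over images only.\<close>

lemma sat_quotient:
  assumes "surj f" and "\<And>x y. f x = f y \<longleftrightarrow> Q x y" and "\<And>x y. M' (f x) (f y) \<longleftrightarrow> M x y"
  shows "sat (=) M' (\<lambda>n. f (e n)) p \<longleftrightarrow> sat Q M e p"
proof (induction p arbitrary: e)
  case (All p)
  have "case_nat (f a) (\<lambda>n. f (e n)) = (\<lambda>n. f (case_nat a e n))" for a
    by (auto split: nat.split)
  then have "(\<forall>a. sat (=) M' (case_nat (f a) (\<lambda>n. f (e n))) p) \<longleftrightarrow> sat Q M e (\<^bold>\<forall>p)"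
    using All by simp
  then show ?case using assms(1) by (simp) (metis surjD)
qed (auto simp: assms)

locale ZF_model =
  fixes M :: "'a \<Rightarrow> 'a \<Rightarrow> bool"  (infix "\<epsilon>" 50)
  assumes sat_ZF: "p \<in> ZF \<Longrightarrow> sat (=) M e p"

text \<open>Every model of ZF is infinite, so the quotient of a countable Henkin model by its equality is
  in bijection with \<open>\<nat>\<close>. This is why a type can serve as the universe.\<close>
theorem ZF_completeness:
  assumes "\<And>(M :: nat \<Rightarrow> nat \<Rightarrow> bool) e. ZF_model M \<Longrightarrow> sat (=) M e p"
  shows "ZF \<turnstile> p"
proof (rule ccontr)
  assume "\<not> (ZF \<turnstile> p)"
  then have "\<not> (insert (\<^bold>\<not> p) ZF \<turnstile> Bot)" using Contr by blast
  \<comment> \<open>\<open>ZF\<close> is infinite but consists of sentences, so only the negated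
    goal contributes free variables.\<close>
  moreover have "finite (\<Union>(fv ` insert (\<^bold>\<not> p) ZF))"
    by (simp add: closed_ZF finite_fv)
  ultimately obtain Q M :: "nat \<Rightarrow> nat \<Rightarrow> bool" where QM: "mem_congruence Q M"
    and sat: "\<And>q. q \<in> insert (\<^bold>\<not> p) ZF \<Longrightarrow> sat Q M (\<lambda>n. n) q"
    using model_existence by blast
  have ZF: "sat Q M e q" if "q \<in> ZF" for q e
    using sat[of q] that sat_cong[of q e "\<lambda>n. n"] closed_ZF by auto
  \<comment> \<open>The predicate \<open>Q x\<close> stands for the class of \<open>x\<close>, and
    \<open>f\<close> numbers the classes.\<close>
  define f where "f = (\<lambda>x. to_nat_on (range Q) (Q x))"
  have bij: "bij_betw (to_nat_on (range Q)) (range Q) UNIV"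
    using infinite_ZF_model[OF QM ZF] by (intro to_nat_on_infinite) auto
  have "surj f" using bij unfolding f_def bij_betw_def by (simp add: image_image[symmetric])
  have f: "f x = f y \<longleftrightarrow> Q x y" for x y
  proof -
    have "f x = f y \<longleftrightarrow> Q x = Q y"
      unfolding f_def by (rule inj_on_eq_iff[OF bij_betw_imp_inj_on[OF bij]]) auto
    then show ?thesis using QM unfolding mem_congruence_def equivp_def by blast
  qed
  define M' where "M' = (\<lambda>x y. M (inv f x) (inv f y))"
  have "Q (inv f (f x)) x" for x by (simp flip: f add: f_inv_into_f)
  then have M': "M' (f x) (f y) \<longleftrightarrow> M x y" for x y
    using QM unfolding M'_def mem_congruence_def by (meson equivp_symp)
  note quot = sat_quotient[where f = f and Q = Q and M = M and M' = M', OF \<open>surj f\<close> f M']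
  have trans: "sat (=) M' e q \<longleftrightarrow> sat Q M (\<lambda>n. inv f (e n)) q" for e q
    using quot[of "\<lambda>n. inv f (e n)" q] \<open>surj f\<close>
    by (simp add: surj_f_inv_f)
  have "ZF_model M'" by unfold_locales (simp add: trans ZF)
  then have "sat (=) M' (\<lambda>n. f n) p" by (rule assms)
  then have "sat Q M (\<lambda>n. n) p" using quot[of "\<lambda>n. n"] by simp
  then show False using sat[of "\<^bold>\<not> p"] by simp
qed


section \<open>Set theory inside a model\<close>

context ZF_model
begin

abbreviation holds :: "(nat \<Rightarrow> 'a) \<Rightarrow> fm \<Rightarrow> bool"  (infix "\<Turnstile>" 50) where
  "e \<Turnstile> p \<equiv> sat (=) M e p"

lemma ext: "(\<And>x. x \<epsilon> a \<longleftrightarrow> x \<epsilon> b) \<Longrightarrow> a = b"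
  using sat_ZF[of extensionality_ax "\<lambda>_. a"]
  by (simp add: ZF_def extensionality_ax_def eval_nat_numeral)

text \<open>The property must be given by a formula, with parameters supplied by \<open>e\<close>.
  \<open>?r\<close> makes \<open>p\<close> skip variable \<open>1\<close>, by which the axiom offers
  the ambient set; the shift built into the axiom skips the new set.\<close>

lemma separation:
  obtains b where "\<And>x. x \<epsilon> b \<longleftrightarrow> x \<epsilon> a \<and> case_nat x e \<Turnstile> p"
proof -
  let ?r = "case_nat 0 (\<lambda>n. Suc (Suc n))"
  have "e \<Turnstile> separation_ax (ren ?r p)"
    by (rule sat_closures, rule sat_ZF) (auto simp: ZF_def)
  then obtain b where b: "\<And>x. x \<epsilon> b \<longleftrightarrow> x \<epsilon> a \<and>
      (\<lambda>n. case_nat x (case_nat b (case_nat a e)) (up Suc (?r n))) \<Turnstile> p"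
    by (auto simp: separation_ax_def sat_ren eval_nat_numeral)
  have "(\<lambda>n. case_nat x (case_nat b (case_nat a e)) (up Suc (?r n))) = case_nat x e" for x
    by (rule HOL.ext) (simp split: nat.split)
  then show thesis using that b by metis
qed

section \<open>Set operations in the model\<close>

definition coll :: "('a \<Rightarrow> bool) \<Rightarrow> 'a" where
  "coll P = (THE z. \<forall>x. x \<epsilon> z \<longleftrightarrow> P x)"

lemma mem_coll: "\<exists>z. \<forall>x. x \<epsilon> z \<longleftrightarrow> P x \<Longrightarrow> x \<epsilon> coll P \<longleftrightarrow> P x"
proof -
  assume "\<exists>z. \<forall>x. x \<epsilon> z \<longleftrightarrow> P x"
  then have "\<exists>!z. \<forall>x. x \<epsilon> z \<longleftrightarrow> P x" using ext by metis
  then show ?thesis unfolding coll_def by (rule the1I2) blast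
qed

definition upair :: "'a \<Rightarrow> 'a \<Rightarrow> 'a" where "upair a b = coll (\<lambda>x. x = a \<or> x = b)"
definition Sup_set :: "'a \<Rightarrow> 'a" where "Sup_set a = coll (\<lambda>x. \<exists>y. y \<epsilon> a \<and> x \<epsilon> y)"
definition Pow_set :: "'a \<Rightarrow> 'a" where "Pow_set a = coll (\<lambda>x. \<forall>y. y \<epsilon> x \<longrightarrow> y \<epsilon> a)"
definition zero :: 'a where "zero = coll (\<lambda>_. False)"
definition union :: "'a \<Rightarrow> 'a \<Rightarrow> 'a" where "union a b = Sup_set (upair a b)"
definition ins :: "'a \<Rightarrow> 'a \<Rightarrow> 'a" where "ins a b = union (upair a a) b"
definition suc :: "'a \<Rightarrow> 'a" where "suc a = ins a a"
definition opair :: "'a \<Rightarrow> 'a \<Rightarrow> 'a" where "opair a b = upair (upair a a) (upair a b)"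

lemma mem_upair [simp]: "x \<epsilon> upair a b \<longleftrightarrow> x = a \<or> x = b"
  unfolding upair_def
  by (rule mem_coll) (use sat_ZF[of pairing_ax] in \<open>simp add: ZF_def pairing_ax_def upair_fm_def eval_nat_numeral\<close>)

lemma mem_Sup_set [simp]: "x \<epsilon> Sup_set a \<longleftrightarrow> (\<exists>y. y \<epsilon> a \<and> x \<epsilon> y)"
  unfolding Sup_set_def
  by (rule mem_coll) (use sat_ZF[of union_ax] in \<open>simp add: ZF_def union_ax_def eval_nat_numeral\<close>)

lemma mem_Pow_set [simp]: "x \<epsilon> Pow_set a \<longleftrightarrow> (\<forall>y. y \<epsilon> x \<longrightarrow> y \<epsilon> a)"
  unfolding Pow_set_def
  by (rule mem_coll) (use sat_ZF[of power_ax] in \<open>simp add: ZF_def power_ax_def subset_fm_def eval_nat_numeral\<close>)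

lemma mem_zero [simp]: "\<not> x \<epsilon> zero"
proof -
  have "\<exists>z. \<forall>x. x \<epsilon> z \<longleftrightarrow> False"
    using sat_ZF[of infinity_ax]
    by (simp add: ZF_def infinity_ax_def inductive_fm_def empty_fm_def) blast
  then show ?thesis unfolding zero_def by (subst mem_coll) auto
qed

lemma mem_union [simp]: "x \<epsilon> union a b \<longleftrightarrow> x \<epsilon> a \<or> x \<epsilon> b"
  by (auto simp: union_def)

lemma mem_ins [simp]: "x \<epsilon> ins a b \<longleftrightarrow> x = a \<or> x \<epsilon> b"
  by (auto simp: ins_def)

lemma mem_suc [simp]: "x \<epsilon> suc a \<longleftrightarrow> x = a \<or> x \<epsilon> a"
  by (auto simp: suc_def)

lemma upair_eq: "upair a b = upair c d \<longleftrightarrow> a = c \<and> b = d \<or> a = d \<and> b = c"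
proof
  assume eq: "upair a b = upair c d"
  have "x = a \<or> x = b \<longleftrightarrow> x = c \<or> x = d" for x
    using mem_upair[of x a b] mem_upair[of x c d] eq by simp
  then show "a = c \<and> b = d \<or> a = d \<and> b = c" by metis
qed (auto intro: ext)

lemma opair_eq [simp]: "opair a b = opair c d \<longleftrightarrow> a = c \<and> b = d"
  by (auto simp: opair_def upair_eq)

text \<open>Provides the ambient set from which separation cuts out sets of pairs:
  \<open>{a}\<close> and \<open>{a, b}\<close> are subsets of \<open>X\<close>.\<close>

lemma opair_mem: "a \<epsilon> X \<Longrightarrow> b \<epsilon> X \<Longrightarrow> opair a b \<epsilon> Pow_set (Pow_set X)"
  by (auto simp: opair_def)

text \<open>Foundation applied to \<open>{x}\<close>. In \<open>walk_step\<close> it makes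
  \<open>suc k\<close> a new index.\<close>

lemma mem_irrefl: "\<not> x \<epsilon> x"
proof -
  have "\<exists>y. y \<epsilon> upair x x \<and> \<not> (\<exists>z. z \<epsilon> y \<and> z \<epsilon> upair x x)"
    using sat_ZF[of foundation_ax]
    by (simp add: ZF_def foundation_ax_def eval_nat_numeral del: mem_upair) (metis mem_upair)
  then show ?thesis by auto
qed

lemma eq_upair_iff: "(\<forall>x. x \<epsilon> z \<longleftrightarrow> x = a \<or> x = b) \<longleftrightarrow> z = upair a b"
  by (auto intro: ext)

lemma eq_suc_iff: "(\<forall>x. x \<epsilon> z \<longleftrightarrow> x \<epsilon> a \<or> x = a) \<longleftrightarrow> z = suc a"
  by (auto intro: ext)

lemma eq_zero_iff: "(\<forall>x. \<not> x \<epsilon> z) \<longleftrightarrow> z = zero"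
  by (auto intro: ext)

section \<open>Functions, graphs and choice principles in the model\<close>

text \<open>From here on the predicates follow the corresponding formulas quantifier by quantifier,
  up to variables fixed by an equation, so that simplification can identify the two.\<close>

definition is_inductive :: "'a \<Rightarrow> bool" where
  "is_inductive w \<longleftrightarrow> zero \<epsilon> w \<and> (\<forall>x. x \<epsilon> w \<longrightarrow> suc x \<epsilon> w)"

definition natural :: "'a \<Rightarrow> bool" where
  "natural n \<longleftrightarrow> (\<forall>w. is_inductive w \<longrightarrow> n \<epsilon> w)"

definition func :: "'a \<Rightarrow> 'a \<Rightarrow> 'a \<Rightarrow> bool" where
  "func f A B \<longleftrightarrow> (\<forall>z. z \<epsilon> f \<longrightarrow> (\<exists>a. a \<epsilon> A \<and> (\<exists>b. b \<epsilon> B \<and> z = opair a b))) \<and>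
    (\<forall>a. a \<epsilon> A \<longrightarrow> (\<exists>b. opair a b \<epsilon> f \<and> (\<forall>b'. opair a b' \<epsilon> f \<longrightarrow> b' = b)))"

definition bijection :: "'a \<Rightarrow> 'a \<Rightarrow> 'a \<Rightarrow> bool" where
  "bijection f A B \<longleftrightarrow> func f A B \<and>
    (\<forall>a. a \<epsilon> A \<longrightarrow> (\<forall>a'. a' \<epsilon> A \<longrightarrow> (\<forall>b. opair a b \<epsilon> f \<and> opair a' b \<epsilon> f \<longrightarrow> a = a'))) \<and>
    (\<forall>b. b \<epsilon> B \<longrightarrow> (\<exists>a. a \<epsilon> A \<and> opair a b \<epsilon> f))"

definition graph :: "'a \<Rightarrow> 'a \<Rightarrow> bool" where
  "graph V E \<longleftrightarrow> (\<forall>u. u \<epsilon> E \<longrightarrow> (\<exists>x. x \<epsilon> V \<and> (\<exists>y. y \<epsilon> V \<and> x \<noteq> y \<and> u = upair x y)))"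

definition walk :: "'a \<Rightarrow> 'a \<Rightarrow> 'a \<Rightarrow> 'a \<Rightarrow> bool" where
  "walk V E x y \<longleftrightarrow> (\<exists>k f. natural k \<and> func f (suc k) V \<and> opair zero x \<epsilon> f \<and> opair k y \<epsilon> f \<and>
    (\<forall>i. i \<epsilon> k \<longrightarrow> (\<exists>a b. opair i a \<epsilon> f \<and> opair (suc i) b \<epsilon> f \<and> upair a b \<epsilon> E)))"

definition component :: "'a \<Rightarrow> 'a \<Rightarrow> 'a \<Rightarrow> bool" where
  "component V E C \<longleftrightarrow> (\<exists>x. x \<epsilon> V \<and> (\<forall>y. y \<epsilon> C \<longleftrightarrow> y \<epsilon> V \<and> walk V E x y))"

definition iso_complete :: "'a \<Rightarrow> 'a \<Rightarrow> 'a \<Rightarrow> bool" where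
  "iso_complete n E C \<longleftrightarrow> (\<exists>f. bijection f n C \<and> (\<forall>i. i \<epsilon> n \<longrightarrow> (\<forall>j. j \<epsilon> n \<longrightarrow> (\<forall>a b.
    opair i a \<epsilon> f \<and> opair j b \<epsilon> f \<longrightarrow> (i \<noteq> j \<longleftrightarrow> upair a b \<epsilon> E)))))"

definition independent :: "'a \<Rightarrow> 'a \<Rightarrow> 'a \<Rightarrow> bool" where
  "independent V E I \<longleftrightarrow> (\<forall>x. x \<epsilon> I \<longrightarrow> x \<epsilon> V) \<and>
    (\<forall>x. x \<epsilon> I \<longrightarrow> (\<forall>y. y \<epsilon> I \<longrightarrow> \<not> upair x y \<epsilon> E))"

definition max_independent :: "'a \<Rightarrow> 'a \<Rightarrow> 'a \<Rightarrow> bool" where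
  "max_independent V E I \<longleftrightarrow> independent V E I \<and>
    \<not> (\<exists>J. independent V E J \<and> (\<forall>x. x \<epsilon> I \<longrightarrow> x \<epsilon> J) \<and> I \<noteq> J)"

definition P_prop :: "'a \<Rightarrow> bool" where
  "P_prop n \<longleftrightarrow> (\<forall>V E. graph V E \<and> (\<forall>C. component V E C \<longrightarrow> iso_complete n E C) \<longrightarrow>
    (\<exists>I. max_independent V E I))"

definition AC_prop :: "'a \<Rightarrow> bool" where
  "AC_prop n \<longleftrightarrow> (\<forall>F. (\<forall>A. A \<epsilon> F \<longrightarrow> (\<exists>f. bijection f n A)) \<longrightarrow>
    (\<exists>c U. func c F U \<and> (\<forall>A. A \<epsilon> F \<longrightarrow> (\<exists>a. a \<epsilon> A \<and> opair A a \<epsilon> c))))"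

lemma sat_fm_simps [simp]:
  "e \<Turnstile> subset_fm x y \<longleftrightarrow> (\<forall>z. z \<epsilon> e x \<longrightarrow> z \<epsilon> e y)"
  "e \<Turnstile> empty_fm x \<longleftrightarrow> e x = zero"
  "e \<Turnstile> upair_fm x y z \<longleftrightarrow> e z = upair (e x) (e y)"
  "e \<Turnstile> succ_fm x y \<longleftrightarrow> e y = suc (e x)"
  by (simp_all add: subset_fm_def empty_fm_def upair_fm_def succ_fm_def
      eq_upair_iff eq_suc_iff eq_zero_iff)

lemma sat_pair_fm [simp]: "e \<Turnstile> pair_fm x y z \<longleftrightarrow> e z = opair (e x) (e y)"
  by (simp add: pair_fm_def opair_def eval_nat_numeral)

lemma sat_app_fm [simp]: "e \<Turnstile> app_fm f x y \<longleftrightarrow> opair (e x) (e y) \<epsilon> e f"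
  by (simp add: app_fm_def)

lemma sat_inductive_fm [simp]: "e \<Turnstile> inductive_fm w \<longleftrightarrow> is_inductive (e w)"
  by (simp add: inductive_fm_def is_inductive_def)

lemma sat_nat_fm [simp]: "e \<Turnstile> nat_fm n \<longleftrightarrow> natural (e n)"
  by (simp add: nat_fm_def natural_def)

lemma sat_ge_two_fm [simp]:
  "e \<Turnstile> ge_two_fm n \<longleftrightarrow> suc (suc zero) \<epsilon> e n \<or> suc (suc zero) = e n"
  by (simp add: ge_two_fm_def eval_nat_numeral)

lemma sat_function_fm [simp]: "e \<Turnstile> function_fm f A B \<longleftrightarrow> func (e f) (e A) (e B)"
  by (simp add: function_fm_def func_def eval_nat_numeral)

lemma sat_bijection_fm [simp]: "e \<Turnstile> bijection_fm f A B \<longleftrightarrow> bijection (e f) (e A) (e B)"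
  by (simp add: bijection_fm_def bijection_def eval_nat_numeral)

lemma sat_graph_fm [simp]: "e \<Turnstile> graph_fm V E \<longleftrightarrow> graph (e V) (e E)"
  by (simp add: graph_fm_def graph_def eval_nat_numeral)

lemma sat_adjacent_fm [simp]: "e \<Turnstile> adjacent_fm E x y \<longleftrightarrow> upair (e x) (e y) \<epsilon> e E"
  by (simp add: adjacent_fm_def)

lemma sat_walk_fm [simp]: "e \<Turnstile> walk_fm V E x y \<longleftrightarrow> walk (e V) (e E) (e x) (e y)"
  by (simp add: walk_fm_def walk_def eval_nat_numeral)

lemma sat_component_fm [simp]: "e \<Turnstile> component_fm V E C \<longleftrightarrow> component (e V) (e E) (e C)"
  by (simp add: component_fm_def component_def eval_nat_numeral)

lemma sat_iso_complete_fm [simp]: "e \<Turnstile> iso_complete_fm n E C \<longleftrightarrow> iso_complete (e n) (e E) (e C)"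
  by (simp add: iso_complete_fm_def iso_complete_def eval_nat_numeral)

lemma sat_independent_fm [simp]: "e \<Turnstile> independent_fm V E I \<longleftrightarrow> independent (e V) (e E) (e I)"
  by (simp add: independent_fm_def independent_def eval_nat_numeral)

lemma sat_max_independent_fm [simp]:
  "e \<Turnstile> max_independent_fm V E I \<longleftrightarrow> max_independent (e V) (e E) (e I)"
  by (simp add: max_independent_fm_def max_independent_def)

lemma sat_P_fm [simp]: "e \<Turnstile> P_fm n \<longleftrightarrow> P_prop (e n)"
  by (simp add: P_fm_def P_prop_def eval_nat_numeral)

lemma sat_AC_fm [simp]: "e \<Turnstile> AC_fm n \<longleftrightarrow> AC_prop (e n)"
  by (simp add: AC_fm_def AC_prop_def eval_nat_numeral)

section \<open>Induction on the natural numbers of the model\<close>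

lemma natural_zero: "natural zero"
  by (simp add: natural_def is_inductive_def)

lemma natural_suc: "natural n \<Longrightarrow> natural (suc n)"
  by (simp add: natural_def is_inductive_def)

text \<open>The model may contain nonstandard natural numbers, so induction is restricted to
  properties defined by a formula with parameters. Separation then yields an inductive set of
  natural numbers with the property, and \<open>k\<close> belongs to it.\<close>

lemma natural_induct:
  assumes "natural k" and "P zero" and step: "\<And>i. natural i \<Longrightarrow> P i \<Longrightarrow> P (suc i)"
    and P: "\<And>i. P i \<longleftrightarrow> case_nat i e \<Turnstile> p"
  shows "P k"
proof -
  obtain W where W: "is_inductive W"
    using sat_ZF[of infinity_ax] by (auto simp: ZF_def infinity_ax_def)
  obtain b where b: "\<And>i. i \<epsilon> b \<longleftrightarrow> i \<epsilon> W \<and> case_nat i e \<Turnstile> (nat_fm 0 \<^bold>\<and> p)"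
    using separation[of W e "nat_fm 0 \<^bold>\<and> p"] by metis
  have "is_inductive b"
    using W assms(2) step natural_zero natural_suc
    unfolding is_inductive_def b by (simp flip: P)
  then have "k \<epsilon> b" using assms(1) by (simp add: natural_def)
  then show ?thesis by (simp add: b flip: P)
qed

text \<open>Internal induction; below the two bounded quantifiers \<open>k\<close> has become
  variable \<open>2\<close>. Serves to pass from \<open>suc i \<epsilon> k\<close> to
  \<open>i \<epsilon> k\<close> along walks.\<close>

lemma natural_transitive:
  assumes "natural k"
  shows "\<forall>i. i \<epsilon> k \<longrightarrow> (\<forall>j. j \<epsilon> i \<longrightarrow> j \<epsilon> k)"
  by (rule natural_induct[where e = "\<lambda>_. k" and p = "\<^bold>\<forall>\<in>0. \<^bold>\<forall>\<in>0. 0 \<^bold>\<in> 2", OF assms])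
    (auto simp: eval_nat_numeral)

section \<open>Functions, walks and components\<close>

lemma func_unique:
  assumes "func f A B" and "opair a b \<epsilon> f" and "opair a b' \<epsilon> f"
  shows "b = b'"
proof -
  have "a \<epsilon> A" using assms(1,2) unfolding func_def by force
  then show ?thesis using assms unfolding func_def by metis
qed

lemma func_range: "func f A B \<Longrightarrow> opair a b \<epsilon> f \<Longrightarrow> a \<epsilon> A \<and> b \<epsilon> B"
  unfolding func_def by force

lemma graph_edge:
  assumes "graph V E" and "upair x y \<epsilon> E"
  shows "x \<epsilon> V" and "y \<epsilon> V" and "x \<noteq> y"
proof -
  obtain u v where "u \<epsilon> V" "v \<epsilon> V" "u \<noteq> v" "upair x y = upair u v"
    using assms unfolding graph_def by blast
  then show "x \<epsilon> V" and "y \<epsilon> V" and "x \<noteq> y" by (auto simp: upair_eq)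
qed

text \<open>The walk of length zero, \<open>{(0, x)}\<close>, has no edges to check.\<close>

lemma walk_refl:
  assumes "x \<epsilon> V"
  shows "walk V E x x"
  unfolding walk_def
proof (intro exI conjI)
  show "natural zero" by (rule natural_zero)
  show "func (upair (opair zero x) (opair zero x)) (suc zero) V"
    using assms by (auto simp: func_def)
qed auto

lemma walk_step:
  assumes "walk V E x y" and yz: "upair y z \<epsilon> E" and z: "z \<epsilon> V"
  shows "walk V E x z"
proof -
  obtain k f where k: "natural k" and f: "func f (suc k) V" "opair zero x \<epsilon> f" "opair k y \<epsilon> f"
    and edges: "\<And>i. i \<epsilon> k \<Longrightarrow> \<exists>a b. opair i a \<epsilon> f \<and> opair (suc i) b \<epsilon> f \<and> upair a b \<epsilon> E"
    using assms(1) unfolding walk_def by blast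
  \<comment> \<open>The walk is prolonged by the index \<open>suc k\<close> with value
    \<open>z\<close>. By foundation this index is not in the domain \<open>suc k\<close> of
    \<open>f\<close>, so \<open>?g\<close> stays single-valued.\<close>
  let ?g = "ins (opair (suc k) z) f"
  have new: "\<not> opair (suc k) b \<epsilon> f" for b
    using func_range[OF f(1)] mem_irrefl by blast
  have "func ?g (suc (suc k)) V"
    unfolding func_def
  proof (intro conjI allI impI)
    fix u assume "u \<epsilon> ?g"
    then consider "u = opair (suc k) z" | "u \<epsilon> f" by auto
    then show "\<exists>a. a \<epsilon> suc (suc k) \<and> (\<exists>b. b \<epsilon> V \<and> u = opair a b)"
    proof cases
      case 1
      then show ?thesis using z by auto
    next
      case 2
      then obtain a b where "a \<epsilon> suc k" "b \<epsilon> V" "u = opair a b"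
        using f(1) unfolding func_def by blast
      then show ?thesis by auto
    qed
  next
    fix a assume a: "a \<epsilon> suc (suc k)"
    show "\<exists>b. opair a b \<epsilon> ?g \<and> (\<forall>b'. opair a b' \<epsilon> ?g \<longrightarrow> b' = b)"
    proof (cases "a = suc k")
      case True
      then show ?thesis using new by auto
    next
      case False
      then have "a \<epsilon> suc k" using a by simp
      then have "\<exists>b. opair a b \<epsilon> f \<and> (\<forall>b'. opair a b' \<epsilon> f \<longrightarrow> b' = b)"
        using f(1) unfolding func_def by blast
      then show ?thesis using False by simp
    qed
  qed
  moreover have "\<exists>a b. opair i a \<epsilon> ?g \<and> opair (suc i) b \<epsilon> ?g \<and> upair a b \<epsilon> E" if "i \<epsilon> suc k" for i
  proof (cases "i = k")
    case True
    then show ?thesis using f(3) yz by auto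
  next
    case False
    then show ?thesis using that edges[of i] by auto
  qed
  ultimately show ?thesis
    using natural_suc[OF k] f(2) unfolding walk_def by (intro exI[of _ "suc k"] exI[of _ ?g]) auto
qed

lemma component_closed:
  assumes "graph V E" and "component V E C" and "x \<epsilon> C" and "upair x y \<epsilon> E"
  shows "y \<epsilon> C"
  using assms walk_step graph_edge(2)[OF assms(1,4)] unfolding component_def by blast

text \<open>Distinct points have distinct preimages because the isomorphism is
  single-valued.\<close>

lemma iso_complete_adjacent:
  assumes "iso_complete n E C" and "x \<epsilon> C" and "y \<epsilon> C" and "x \<noteq> y"
  shows "upair x y \<epsilon> E"
proof -
  obtain f where f: "bijection f n C" and E: "\<And>i j a b. i \<epsilon> n \<Longrightarrow> j \<epsilon> n \<Longrightarrow>
      opair i a \<epsilon> f \<Longrightarrow> opair j b \<epsilon> f \<Longrightarrow> i \<noteq> j \<longleftrightarrow> upair a b \<epsilon> E"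
    using assms(1) unfolding iso_complete_def by blast
  obtain i j where "i \<epsilon> n" "opair i x \<epsilon> f" "j \<epsilon> n" "opair j y \<epsilon> f"
    using f assms(2,3) unfolding bijection_def by blast
  moreover from this have "i \<noteq> j"
    using f assms(4) func_unique unfolding bijection_def by blast
  ultimately show ?thesis using E by blast
qed

section \<open>From choice functions to maximal independent sets\<close>

theorem AC_imp_P:
  assumes "AC_prop n"
  shows "P_prop n"
  unfolding P_prop_def
proof (intro allI impI, elim conjE)
  fix V E
  assume graph: "graph V E" and "\<forall>C. component V E C \<longrightarrow> iso_complete n E C"
  then have iso: "\<And>C. component V E C \<Longrightarrow> iso_complete n E C" by blast
  \<comment> \<open>The components form a set, cut out of the power set of \<open>V\<close>; the
    assignment makes \<open>C\<close>, \<open>V\<close>, \<open>E\<close> the variables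
    \<open>0\<close>, \<open>1\<close>, \<open>2\<close>.\<close>
  obtain F where "\<And>C. C \<epsilon> F \<longleftrightarrow> C \<epsilon> Pow_set V \<and>
      case_nat C (case_nat V (\<lambda>_. E)) \<Turnstile> component_fm 1 2 0"
    using separation[of "Pow_set V" "case_nat V (\<lambda>_. E)" "component_fm 1 2 0"] by metis
  then have F: "C \<epsilon> F \<longleftrightarrow> component V E C" for C
    by (auto simp: eval_nat_numeral component_def)
  have "\<exists>f. bijection f n A" if "A \<epsilon> F" for A
    using iso that unfolding F iso_complete_def by blast
  then obtain c U where c: "func c F U" "\<And>A. A \<epsilon> F \<Longrightarrow> \<exists>a. a \<epsilon> A \<and> opair A a \<epsilon> c"
    using assms unfolding AC_prop_def by blast
  have c_mem: "a \<epsilon> A" "component V E A" if "opair A a \<epsilon> c" for A a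
    using that c func_range[OF c(1)] func_unique[OF c(1)] F by blast+
  obtain I where "\<And>y. y \<epsilon> I \<longleftrightarrow> y \<epsilon> V \<and>
      case_nat y (case_nat c (\<lambda>_. c)) \<Turnstile> (\<^bold>\<exists>app_fm 2 0 1)"
    using separation[of V "case_nat c (\<lambda>_. c)" "\<^bold>\<exists>app_fm 2 0 1"] by metis
  then have I: "y \<epsilon> I \<longleftrightarrow> y \<epsilon> V \<and> (\<exists>A. opair A y \<epsilon> c)" for y
    by (simp add: eval_nat_numeral)
  \<comment> \<open>Components sharing \<open>x\<close> coincide: any other \<open>z\<close> in one
    is adjacent to \<open>x\<close> by completeness, and the other is closed under adjacency. This
    avoids reversing and concatenating walks.\<close>
  have sub: "A \<epsilon> F \<Longrightarrow> B \<epsilon> F \<Longrightarrow> x \<epsilon> A \<Longrightarrow> x \<epsilon> B \<Longrightarrow> z \<epsilon> A \<Longrightarrow> z \<epsilon> B" for A B x z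
    using iso_complete_adjacent[OF iso] component_closed[OF graph] unfolding F by metis
  have "independent V E I"
    unfolding independent_def
  proof (intro conjI allI impI notI)
    fix x y assume "x \<epsilon> I" "y \<epsilon> I" and xy: "upair x y \<epsilon> E"
    then obtain A B where A: "opair A x \<epsilon> c" and B: "opair B y \<epsilon> c" by (auto simp: I)
    have "y \<epsilon> A" using component_closed[OF graph _ _ xy] c_mem[OF A] by blast
    then have "A = B" using sub c_mem[OF A] c_mem[OF B] F by (intro ext) metis
    then have "x = y" using A B func_unique[OF c(1)] by blast
    then show False using graph_edge(3)[OF graph xy] by blast
  qed (simp add: I)
  moreover have "I = J" if J: "independent V E J" and IJ: "\<forall>x. x \<epsilon> I \<longrightarrow> x \<epsilon> J" for J
  proof (rule ext)
    fix z
    show "z \<epsilon> I \<longleftrightarrow> z \<epsilon> J"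
    proof
      assume z: "z \<epsilon> J"
      then have zV: "z \<epsilon> V" using J by (simp add: independent_def)
      \<comment> \<open>The component of \<open>z\<close> contains a chosen \<open>a\<close>, which
        also lies in \<open>J\<close>. If \<open>a\<close> and \<open>z\<close> differed they would
        be adjacent, against the independence of \<open>J\<close>.\<close>
      obtain A where "\<And>y. y \<epsilon> A \<longleftrightarrow> y \<epsilon> V \<and>
          case_nat y (case_nat V (case_nat E (\<lambda>_. z))) \<Turnstile> walk_fm 1 2 3 0"
        using separation[of V "case_nat V (case_nat E (\<lambda>_. z))" "walk_fm 1 2 3 0"] by metis
      then have A: "y \<epsilon> A \<longleftrightarrow> y \<epsilon> V \<and> walk V E z y" for y by (simp add: eval_nat_numeral)
      have AC: "component V E A" using zV A unfolding component_def by blast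
      have zA: "z \<epsilon> A" using A zV walk_refl by blast
      obtain a where a: "a \<epsilon> A" "opair A a \<epsilon> c" using c(2)[of A] AC F by blast
      have "a \<epsilon> J" using IJ I A a by blast
      then have "a = z"
        using J z iso_complete_adjacent[OF iso[OF AC] a(1) zA] unfolding independent_def by blast
      then show "z \<epsilon> I" using I zV a by blast
    qed (use IJ in blast)
  qed
  ultimately show "\<exists>I. max_independent V E I" unfolding max_independent_def by blast
qed

section \<open>From maximal independent sets to choice functions\<close>

theorem P_imp_AC:
  assumes "P_prop n" and n: "m \<epsilon> n"
  shows "AC_prop n"
  unfolding AC_prop_def
proof (intro allI impI)
  fix F
  assume "\<forall>A. A \<epsilon> F \<longrightarrow> (\<exists>f. bijection f n A)"
  then have bij: "\<And>A. A \<epsilon> F \<Longrightarrow> \<exists>f. bijection f n A" by blast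
  \<comment> \<open>The tag \<open>A\<close> in \<open>(A, a)\<close> keeps the fibres disjoint even
    when members of \<open>F\<close> overlap.\<close>
  obtain V where "\<And>z. z \<epsilon> V \<longleftrightarrow> z \<epsilon> Pow_set (Pow_set (union F (Sup_set F))) \<and>
      case_nat z (\<lambda>_. F) \<Turnstile> (\<^bold>\<exists>\<in>1. \<^bold>\<exists>\<in>0. pair_fm 1 0 2)"
    using separation[of "Pow_set (Pow_set (union F (Sup_set F)))" "\<lambda>_. F" "\<^bold>\<exists>\<in>1. \<^bold>\<exists>\<in>0. pair_fm 1 0 2"]
    by metis
  then have V: "z \<epsilon> V \<longleftrightarrow> (\<exists>A a. A \<epsilon> F \<and> a \<epsilon> A \<and> z = opair A a)" for z
    by (auto simp: eval_nat_numeral simp del: mem_Pow_set intro!: opair_mem)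
  \<comment> \<open>Innermost, the variables \<open>0\<close> to \<open>5\<close> are
    \<open>(A, b)\<close>, \<open>(A, a)\<close>, \<open>b\<close>, \<open>a\<close>,
    \<open>A\<close>, \<open>w\<close>.\<close>
  let ?e = "\<^bold>\<exists>\<in>1. \<^bold>\<exists>\<in>0. \<^bold>\<exists>\<in>1. (\<^bold>\<not> 0 \<^bold>= 1 \<^bold>\<and> (\<^bold>\<exists>\<^bold>\<exists>(pair_fm 4 3 1 \<^bold>\<and> pair_fm 4 2 0 \<^bold>\<and> upair_fm 1 0 5)))"
  obtain E where "\<And>w. w \<epsilon> E \<longleftrightarrow> w \<epsilon> Pow_set V \<and> case_nat w (\<lambda>_. F) \<Turnstile> ?e"
    using separation[of "Pow_set V" "\<lambda>_. F" ?e] by metis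
  then have E: "w \<epsilon> E \<longleftrightarrow> (\<exists>A a b. A \<epsilon> F \<and> a \<epsilon> A \<and> b \<epsilon> A \<and> a \<noteq> b \<and> w = upair (opair A a) (opair A b))" for w
    by (simp add: eval_nat_numeral) (auto simp: V)
  have adj: "upair (opair A a) y \<epsilon> E \<longleftrightarrow> A \<epsilon> F \<and> a \<epsilon> A \<and> (\<exists>b. b \<epsilon> A \<and> a \<noteq> b \<and> y = opair A b)" for A a y
    unfolding E upair_eq by (auto; metis)
  have graph: "graph V E" unfolding graph_def E V by (metis opair_eq)
  have walk_fst: "\<exists>a. y = opair A a" if walk: "walk V E (opair A a0) y" for A a0 y
  proof -
    obtain k f where k: "natural k" and f: "func f (suc k) V" "opair zero (opair A a0) \<epsilon> f" "opair k y \<epsilon> f"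
      and edges: "\<And>i. i \<epsilon> k \<Longrightarrow> \<exists>a b. opair i a \<epsilon> f \<and> opair (suc i) b \<epsilon> f \<and> upair a b \<epsilon> E"
      using walk unfolding walk_def by blast
    \<comment> \<open>Edges preserve the first coordinate. The induction runs over all natural
      numbers, so the claim is guarded by membership in \<open>suc k\<close>, the domain of
      \<open>f\<close>.\<close>
    have "k \<epsilon> suc k \<longrightarrow> (\<forall>v. opair k v \<epsilon> f \<longrightarrow> (\<exists>a. v = opair A a))"
    proof (rule natural_induct[where P = "\<lambda>i. i \<epsilon> suc k \<longrightarrow> (\<forall>v. opair i v \<epsilon> f \<longrightarrow> (\<exists>a. v = opair A a))"
        and e = "case_nat (suc k) (case_nat f (\<lambda>_. A))"
        and p = "0 \<^bold>\<in> 1 \<^bold>\<longrightarrow> (\<^bold>\<forall>(app_fm 3 1 0 \<^bold>\<longrightarrow> (\<^bold>\<exists>pair_fm 5 0 1)))", OF k])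
      show "zero \<epsilon> suc k \<longrightarrow> (\<forall>v. opair zero v \<epsilon> f \<longrightarrow> (\<exists>a. v = opair A a))"
        using func_unique[OF f(1) f(2)] by metis
      show "suc i \<epsilon> suc k \<longrightarrow> (\<forall>v. opair (suc i) v \<epsilon> f \<longrightarrow> (\<exists>a. v = opair A a))"
        if IH: "i \<epsilon> suc k \<longrightarrow> (\<forall>v. opair i v \<epsilon> f \<longrightarrow> (\<exists>a. v = opair A a))" for i
      proof (intro allI impI)
        fix v assume "suc i \<epsilon> suc k" and v: "opair (suc i) v \<epsilon> f"
        then consider "suc i = k" | "suc i \<epsilon> k" by auto
        \<comment> \<open>If \<open>suc i = k\<close> this is immediate; otherwise \<open>k\<close>
          is transitive.\<close>
        then have i: "i \<epsilon> k"
          by cases (use natural_transitive[OF k] mem_suc in blast)+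
        then obtain u w where "opair i u \<epsilon> f" "opair (suc i) w \<epsilon> f" "upair u w \<epsilon> E"
          using edges by blast
        moreover from this have "w = v" using v func_unique[OF f(1)] by blast
        moreover obtain a where "u = opair A a" using IH i calculation(1) by auto
        ultimately show "\<exists>a. v = opair A a" by (auto simp: adj)
      qed
    qed (simp add: eval_nat_numeral)
    then show ?thesis using f(3) by auto
  qed
  have "iso_complete n E C" if comp: "component V E C" for C
  proof -
    obtain x where x: "x \<epsilon> V" "\<And>y. y \<epsilon> C \<longleftrightarrow> y \<epsilon> V \<and> walk V E x y"
      using comp unfolding component_def by blast
    obtain A a0 where A: "A \<epsilon> F" "a0 \<epsilon> A" "x = opair A a0" using x(1) V by blast
    \<comment> \<open>Every other vertex over \<open>A\<close> is one edge away from
      \<open>x\<close>; with \<open>walk_fst\<close> this gives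
      \<open>C = {A} \<times> A\<close>.\<close>
    have "opair A a \<epsilon> C" if "a \<epsilon> A" for a
    proof (cases "a = a0")
      case True
      then show ?thesis using x A walk_refl by blast
    next
      case False
      then have "upair x (opair A a) \<epsilon> E" using A that by (auto simp: adj)
      then show ?thesis using x walk_step[OF walk_refl] graph_edge(2)[OF graph] by blast
    qed
    moreover have "\<exists>a. a \<epsilon> A \<and> y = opair A a" if "y \<epsilon> C" for y
      using that walk_fst x(2) A(3) V by (metis opair_eq)
    ultimately have C: "y \<epsilon> C \<longleftrightarrow> (\<exists>a. a \<epsilon> A \<and> y = opair A a)" for y by blast
    obtain h where h: "bijection h n A" using bij A by blast
    let ?B = "Pow_set (Pow_set (union n C))"
    \<comment> \<open>The isomorphism sends \<open>i\<close> to \<open>(A, h(i))\<close>. Innermost,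
      variable \<open>0\<close> is \<open>(A, a)\<close>, followed by \<open>a\<close>,
      \<open>i\<close>, \<open>z\<close>, \<open>n\<close>, \<open>h\<close>,
      \<open>A\<close>.\<close>
    let ?g = "\<^bold>\<exists>\<in>1. \<^bold>\<exists>\<in>4. (app_fm 4 1 0 \<^bold>\<and> (\<^bold>\<exists>(pair_fm 6 1 0 \<^bold>\<and> pair_fm 2 0 3)))"
    obtain g where "\<And>z. z \<epsilon> g \<longleftrightarrow> z \<epsilon> ?B \<and>
        case_nat z (case_nat n (case_nat h (\<lambda>_. A))) \<Turnstile> ?g"
      using separation[of ?B "case_nat n (case_nat h (\<lambda>_. A))" ?g] by metis
    then have "z \<epsilon> g \<longleftrightarrow> (\<exists>i a. i \<epsilon> n \<and> a \<epsilon> A \<and> opair i a \<epsilon> h \<and> z = opair i (opair A a))" for z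
      by (auto simp: eval_nat_numeral C simp del: mem_Pow_set intro!: opair_mem)
    then have g: "z \<epsilon> g \<longleftrightarrow> (\<exists>i a. opair i a \<epsilon> h \<and> z = opair i (opair A a))" for z
      using h func_range unfolding bijection_def by blast
    have hfun: "func h n A" using h by (simp add: bijection_def)
    have "func g n C"
      unfolding func_def
    proof (intro conjI allI impI)
      fix z assume "z \<epsilon> g"
      then show "\<exists>i. i \<epsilon> n \<and> (\<exists>b. b \<epsilon> C \<and> z = opair i b)"
        using g C func_range[OF hfun] by blast
    next
      fix i assume "i \<epsilon> n"
      then obtain a where "opair i a \<epsilon> h" using hfun unfolding func_def by blast
      then show "\<exists>b. opair i b \<epsilon> g \<and> (\<forall>b'. opair i b' \<epsilon> g \<longrightarrow> b' = b)"
        using func_unique[OF hfun] by (intro exI[of _ "opair A a"]) (auto simp: g)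
    qed
    moreover have "i = i'" if b: "opair i b \<epsilon> g" "opair i' b \<epsilon> g" for i i' b
    proof -
      obtain a where "opair i a \<epsilon> h" "opair i' a \<epsilon> h" using b by (auto simp: g)
      then show ?thesis using h func_range[OF hfun] unfolding bijection_def by blast
    qed
    moreover have "\<exists>i. i \<epsilon> n \<and> opair i b \<epsilon> g" if "b \<epsilon> C" for b
      using that h by (auto simp: bijection_def C g)
    ultimately have "bijection g n C" unfolding bijection_def by blast
    moreover have "i \<noteq> j \<longleftrightarrow> upair a b \<epsilon> E" if "opair i a \<epsilon> g" "opair j b \<epsilon> g" for i j a b
    proof -
      obtain a' b' where ab: "opair i a' \<epsilon> h" "a = opair A a'" "opair j b' \<epsilon> h" "b = opair A b'"
        using \<open>opair i a \<epsilon> g\<close> \<open>opair j b \<epsilon> g\<close> by (auto simp: g)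
      have "i \<epsilon> n" "j \<epsilon> n" "a' \<epsilon> A" "b' \<epsilon> A" using ab func_range[OF hfun] by blast+
      moreover have "i = j \<longleftrightarrow> a' = b'"
        using ab \<open>i \<epsilon> n\<close> \<open>j \<epsilon> n\<close> h func_unique[OF hfun] unfolding bijection_def by blast
      ultimately show ?thesis using A(1) by (simp add: ab adj)
    qed
    ultimately show ?thesis unfolding iso_complete_def by blast
  qed
  then obtain I where "max_independent V E I" using assms graph unfolding P_prop_def by blast
  then have I: "independent V E I"
    and max: "\<And>J. independent V E J \<Longrightarrow> \<forall>x. x \<epsilon> I \<longrightarrow> x \<epsilon> J \<Longrightarrow> I = J"
    unfolding max_independent_def by blast+
  have IV: "A \<epsilon> F" "a \<epsilon> A" if "opair A a \<epsilon> I" for A a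
    using that I by (auto simp: independent_def V)
  have unique: "a = b" if "opair A a \<epsilon> I" "opair A b \<epsilon> I" for A a b
  proof (rule ccontr)
    assume "a \<noteq> b"
    then have "upair (opair A a) (opair A b) \<epsilon> E" using IV that by (simp add: adj)
    then show False using I that by (simp add: independent_def)
  qed
  have exists: "\<exists>a. opair A a \<epsilon> I" if A: "A \<epsilon> F" for A
  proof (rule ccontr)
    assume none: "\<not> (\<exists>a. opair A a \<epsilon> I)"
    \<comment> \<open>The image of \<open>m\<close> under \<open>h\<close> shows that
      \<open>A\<close> is nonempty. If \<open>I\<close> missed its fibre, a vertex \<open>?v\<close>
      over \<open>A\<close> could be added, since all neighbours of \<open>?v\<close> lie over
      \<open>A\<close>.\<close>
    obtain h where "bijection h n A" using bij A by blast
    then obtain a where a: "a \<epsilon> A"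
      using n func_range unfolding bijection_def func_def by blast
    let ?v = "opair A a"
    have nadj: "\<not> upair ?v y \<epsilon> E" if "y \<epsilon> ins ?v I" for y
      using that none graph_edge(3)[OF graph, of ?v ?v] by (auto simp: adj)
    \<comment> \<open>Adjacency is symmetric, so \<open>nadj\<close> covers pairs with
      \<open>?v\<close> in either position.\<close>
    have "upair x y = upair y x" for x y by (auto simp: upair_eq)
    then have "independent V E (ins ?v I)"
      using I nadj A a unfolding independent_def by (auto simp: V)
    then have "I = ins ?v I" by (rule max) simp
    then show False using none mem_ins by metis
  qed
  \<comment> \<open>\<open>I\<close> itself is the function: \<open>exists\<close> gives totality,
    \<open>unique\<close> single-valuedness.\<close>
  have "func I F (Sup_set F)"
    unfolding func_def
  proof (intro conjI allI impI)
    fix z assume "z \<epsilon> I"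
    then show "\<exists>A. A \<epsilon> F \<and> (\<exists>a. a \<epsilon> Sup_set F \<and> z = opair A a)"
      using I V unfolding independent_def by (metis mem_Sup_set)
  qed (use exists unique in blast)
  moreover have "\<exists>a. a \<epsilon> A \<and> opair A a \<epsilon> I" if "A \<epsilon> F" for A
    using exists[OF that] IV by blast
  ultimately show "\<exists>c U. func c F U \<and> (\<forall>A. A \<epsilon> F \<longrightarrow> (\<exists>a. a \<epsilon> A \<and> opair A a \<epsilon> c))" by blast
qed

lemma P_iff_AC:
  assumes "suc (suc zero) \<epsilon> n \<or> suc (suc zero) = n"
  shows "P_prop n \<longleftrightarrow> AC_prop n"
proof -
  \<comment> \<open>\<open>suc (suc zero)\<close> is a member of \<open>n\<close> in the first case,
    \<open>suc zero\<close> in the second.\<close>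
  obtain m where "m \<epsilon> n" using assms by (metis mem_suc)
  then show ?thesis using AC_imp_P P_imp_AC by blast
qed

end

theorem proposition3p2:
  shows "ZF \<turnstile> (\<^bold>\<forall>(nat_fm 0 \<^bold>\<and> ge_two_fm 0 \<^bold>\<longrightarrow> (P_fm 0 \<^bold>\<longleftrightarrow> AC_fm 0)))"
proof (rule ZF_completeness)
  fix M :: "nat \<Rightarrow> nat \<Rightarrow> bool" and e
  assume "ZF_model M"
  then interpret ZF_model M .
  show "sat (=) M e (\<^bold>\<forall>(nat_fm 0 \<^bold>\<and> ge_two_fm 0 \<^bold>\<longrightarrow> (P_fm 0 \<^bold>\<longleftrightarrow> AC_fm 0)))"
    by (simp add: P_iff_AC)
qed

end
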